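(* Let $\Gamma$ be a non-empty set and let $A(\Gamma)=\Gamma\cup\{\infty\}$ be the one-point compactification of $\Gamma$ equipped with the discrete topology. Then $A(\Gamma)$ admits local compensation, and therefore $C(A(\Gamma))$ has the Bishop-Phelps-Bollobás (BPB) property for numerical radius.
   Context: All Banach spaces are real. For a compact Hausdorff space $K$, $C(K)$ is the Banach space of continuous real-valued functions on $K$ with the supremum norm; its dual is identified with $\mathcal{M}(K)$, the space of regular Borel signed measures on $K$ with the total variation norm, and $B_{\mathcal{M}(K)}$ is its closed unit ball. $\omega^*$ denotes the weak$^*$ topology of $\mathcal{M}(K)=C(K)^*$. For $\mu\in\mathcal{M}(K)$, $\mu^+$ is its positive part. $\nu\in\mathcal{M}(K)$ is a compensation of $\mu\in\mathcal{M}(K)$ if: $0\le\nu\le\mu^+$ and $\nu(K)=\mu(K)$ in case $\mu(K)>0$; and $\nu=0$ in case $\mu(K)\le 0$. $W(K)$ is the set of all $\omega^*$-continuous functions $F\colon K\to B_{\mathcal{M}(K)}$. $G\in W(K)$ is a compensation of $F\in W(K)$ if $G(t)$ is a compensation of $F(t)$ for every $t\in K$. $K$ admits local compensation if every element of $W(K)$ admits a compensation (in $W(K)$). For a Banach space $X$, $\mathfrak{L}(X)$ is the space of bounded linear operators $X\to X$, $\Pi(X)=\{(x,x^* )\in S_X\times S_{X^*}\colon x^*(x)=1\}$ (where $S$ denotes unit spheres), and the numerical radius of $T\in\mathfrak{L}(X)$ is $\nu(T)=\sup\{|x^*(T(x))|\colon (x,x^* )\in\Pi(X)\}$. $X$ has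 the BPB property for numerical radius if there is a function $\delta\colon(0,1)\to(0,1)$ such that: for every $0<\varepsilon<1$, every $T\in\mathfrak{L}(X)$ with $\nu(T)=1$ and every $(x,x^* )\in\Pi(X)$ with $x^*(T(x))\ge 1-\delta(\varepsilon)$, there exist $T_0\in\mathfrak{L}(X)$ with $\nu(T_0)=1$ and $(x_0,x_0^* )\in\Pi(X)$ with $x_0^*(T_0(x_0))=1$ such that $\nu(T-T_0)\le\varepsilon$, $\|x-x_0\|\le\varepsilon$ and $\|x^*-x_0^*\|\le\varepsilon$. *)

theory Defs
  imports "HOL-Analysis.Analysis"
begin

section \<open>Compact Hausdorff spaces and the one-point compactification of a discrete set\<close>

class compact_hausdorff_space = t2_space +
  assumes compact_UNIV_space: "compact UNIV"

text \<open>
  \<open>'g one_point\<close> is the space \<open>A(\<Gamma>)\<close>, where the arbitrary non-empty set \<open>\<Gamma>\<close> is the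
  type \<open>'g\<close>. Its points are those of the library's Alexandroff compactification, where
  \<open>None\<close> is the point at infinity. As usual for \<open>A(\<Gamma>)\<close>, the point at infinity is added also
  when \<open>\<Gamma>\<close> is finite (it is then isolated).
\<close>

typedef 'g one_point = "UNIV :: 'g option set"
  morphisms option_of_one_point one_point_of_option
  by simp

instantiation one_point :: (type) topological_space
begin

definition open_one_point :: "'g one_point set \<Rightarrow> bool" where
  "open_one_point U \<longleftrightarrow>
     openin (Alexandroff_compactification (discrete_topology (UNIV :: 'g set)))
       (option_of_one_point ` U)"

instance
proof
  let ?T = "Alexandroff_compactification (discrete_topology (UNIV :: 'g set))"
  have range: "range option_of_one_point = (UNIV :: 'g option set)"
    by (metis one_point_of_option_inverse UNIV_I surjI)
  have inj: "inj (option_of_one_point :: 'g one_point \<Rightarrow> _)"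
    by (simp add: inj_on_def option_of_one_point_inject)
  have top: "topspace ?T = UNIV"
    by (auto simp: notin_range_Some)
  show "open (UNIV :: 'g one_point set)"
    unfolding open_one_point_def range using openin_topspace[of ?T] unfolding top .
  show "open (S \<inter> T)" if "open S" "open T" for S T :: "'g one_point set"
    using that unfolding open_one_point_def image_Int[OF inj] by (rule openin_Int)
  show "open (\<Union>K)" if "\<forall>S\<in>K. open S" for K :: "'g one_point set set"
    using that unfolding open_one_point_def image_Union by (auto intro: openin_Union)
qed

end

lemma homeomorphic_map_option_of_one_point:
  "homeomorphic_map euclidean (Alexandroff_compactification (discrete_topology (UNIV :: 'g set)))
     option_of_one_point"
proof -
  let ?T = "Alexandroff_compactification (discrete_topology (UNIV :: 'g set))"
  have bij: "bij (option_of_one_point :: 'g one_point \<Rightarrow> _)"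
    by (metis bijI' option_of_one_point_inject one_point_of_option_inverse UNIV_I)
  have top: "topspace ?T = UNIV"
    by (auto simp: notin_range_Some)
  show ?thesis
  proof (rule bijective_open_imp_homeomorphic_map)
    have "option_of_one_point ` (option_of_one_point -` U) = U" for U :: "'g option set"
      by (rule surj_image_vimage_eq) (rule bij_is_surj[OF bij])
    then show "continuous_map euclidean ?T (option_of_one_point :: 'g one_point \<Rightarrow> _)"
      unfolding continuous_map top by (auto simp: open_one_point_def simp flip: vimage_def)
    show "open_map euclidean ?T (option_of_one_point :: 'g one_point \<Rightarrow> _)"
      by (simp add: open_map_def open_one_point_def)
    show "option_of_one_point ` topspace (euclidean :: 'g one_point topology) = topspace ?T"
      unfolding top using bij_is_surj[OF bij] by simp
    show "inj_on option_of_one_point (topspace (euclidean :: 'g one_point topology))"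
      using bij_is_inj[OF bij] by simp
  qed
qed

instance one_point :: (type) compact_hausdorff_space
proof
  let ?T = "Alexandroff_compactification (discrete_topology (UNIV :: 'a set))"
  have hom: "(euclidean :: 'a one_point topology) homeomorphic_space ?T"
    using homeomorphic_map_option_of_one_point homeomorphic_map_imp_homeomorphic_space by blast
  have "Hausdorff_space ?T"
    by (simp add: Hausdorff_space_Alexandroff_compactification
        locally_compact_space_discrete_topology Hausdorff_space_discrete_topology)
  then have "Hausdorff_space (euclidean :: 'a one_point topology)"
    using homeomorphic_Hausdorff_space[OF hom] by simp
  then show "\<exists>U V. open U \<and> open V \<and> x \<in> U \<and> y \<in> V \<and> U \<inter> V = {}"
    if "x \<noteq> y" for x y :: "'a one_point"
    using that by (fastforce simp: Hausdorff_space_def disjnt_def)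
  have "compact_space (euclidean :: 'a one_point topology)"
    using homeomorphic_compact_space[OF hom] by simp
  then show "compact (UNIV :: 'a one_point set)"
    by (simp add: compact_space_def)
qed


section \<open>Regular Borel signed measures\<close>

text \<open>
  A signed measure is a real-valued set function on the Borel sets; to make equality of measures
  equality of functions, it is set to \<open>0\<close> outside the Borel sets. It satisfies \<open>\<mu> {} = 0\<close>, as follows
  from countable additivity for the constant sequence \<open>{}\<close>.
\<close>

definition borel_signed_measure :: "('k::topological_space set \<Rightarrow> real) \<Rightarrow> bool" where
  "borel_signed_measure \<mu> \<longleftrightarrow>
     (\<forall>A. A \<notin> sets borel \<longrightarrow> \<mu> A = 0) \<and>
     (\<forall>A :: nat \<Rightarrow> 'k set. range A \<subseteq> sets borel \<longrightarrow> disjoint_family A \<longrightarrow>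
        (\<lambda>n. \<mu> (A n)) sums \<mu> (\<Union>n. A n))"

text \<open>
  For signed measures the real suprema below are over sets that are bounded above, since a
  real-valued signed measure has finite total variation.
\<close>

definition total_variation :: "('k::topological_space set \<Rightarrow> real) \<Rightarrow> 'k set \<Rightarrow> real" where
  "total_variation \<mu> A =
     (SUP P \<in> {P. finite P \<and> P \<subseteq> sets borel \<and> disjoint P \<and> \<Union>P = A}. \<Sum>B\<in>P. \<bar>\<mu> B\<bar>)"

definition regular_borel_measures :: "('k::topological_space set \<Rightarrow> real) set" where
  "regular_borel_measures =
     {\<mu>. borel_signed_measure \<mu> \<and>
        (\<forall>A\<in>sets borel. \<forall>e>0. \<exists>C U. compact C \<and> open U \<and> C \<subseteq> A \<and> A \<subseteq> U \<and>
           total_variation \<mu> (U - C) < e)}"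

definition measure_unit_ball :: "('k::topological_space set \<Rightarrow> real) set" where
  "measure_unit_ball = {\<mu> \<in> regular_borel_measures. total_variation \<mu> UNIV \<le> 1}"

text \<open>The positive and the negative part of the Jordan decomposition.\<close>

definition pos_part :: "('k::topological_space set \<Rightarrow> real) \<Rightarrow> 'k set \<Rightarrow> real" where
  "pos_part \<mu> A = (SUP B \<in> {B \<in> sets borel. B \<subseteq> A}. \<mu> B)"

definition neg_part :: "('k::topological_space set \<Rightarrow> real) \<Rightarrow> 'k set \<Rightarrow> real" where
  "neg_part \<mu> = pos_part (\<lambda>B. - \<mu> B)"

definition signed_integral :: "('k::topological_space set \<Rightarrow> real) \<Rightarrow> ('k \<Rightarrow> real) \<Rightarrow> real" where
  "signed_integral \<mu> f =
     integral\<^sup>L (measure_of UNIV (sets borel) (\<lambda>A. ennreal (pos_part \<mu> A))) f -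
     integral\<^sup>L (measure_of UNIV (sets borel) (\<lambda>A. ennreal (neg_part \<mu> A))) f"

text \<open>
  The weak* topology that the space of measures has as the dual of \<open>C(K)\<close>, i.e. the coarsest topology
  making \<open>\<mu> \<mapsto> \<integral>f d\<mu>\<close> continuous for all \<open>f \<in> C(K)\<close>. On a compact space \<open>K\<close>, the type
  \<open>'k \<Rightarrow>\<^sub>C real\<close> of bounded continuous functions is \<open>C(K)\<close> with the supremum norm.
\<close>

definition weak_star_topology :: "('k::compact_hausdorff_space set \<Rightarrow> real) topology" where
  "weak_star_topology =
     pullback_topology regular_borel_measures
       (\<lambda>\<mu> (f :: 'k \<Rightarrow>\<^sub>C real). signed_integral \<mu> (apply_bcontfun f))
       (product_topology (\<lambda>_. euclideanreal) UNIV)"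


section \<open>Local compensation\<close>

definition measure_compensation ::
    "('k::compact_hausdorff_space set \<Rightarrow> real) \<Rightarrow> ('k set \<Rightarrow> real) \<Rightarrow> bool" where
  "measure_compensation \<nu> \<mu> \<longleftrightarrow>
     \<nu> \<in> regular_borel_measures \<and>
     (\<mu> UNIV > 0 \<longrightarrow> (\<forall>A\<in>sets borel. 0 \<le> \<nu> A \<and> \<nu> A \<le> pos_part \<mu> A) \<and> \<nu> UNIV = \<mu> UNIV) \<and>
     (\<mu> UNIV \<le> 0 \<longrightarrow> \<nu> = (\<lambda>_. 0))"

definition W_space :: "('k::compact_hausdorff_space \<Rightarrow> 'k set \<Rightarrow> real) set" where
  "W_space = {F. continuous_map euclidean (subtopology weak_star_topology measure_unit_ball) F}"

definition admits_local_compensation :: "'k::compact_hausdorff_space itself \<Rightarrow> bool" where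
  "admits_local_compensation _ \<longleftrightarrow>
     (\<forall>F \<in> (W_space :: ('k \<Rightarrow> 'k set \<Rightarrow> real) set).
        \<exists>G \<in> W_space. \<forall>t. measure_compensation (G t) (F t))"


section \<open>The Bishop-Phelps-Bollobas property for numerical radius\<close>

text \<open>
  The definitions are stated for real normed spaces because the library has the \<open>banach\<close> instance
  of \<open>'k \<Rightarrow>\<^sub>C real\<close> only for metric domains. The dual space is \<open>'x \<Rightarrow>\<^sub>L real\<close>.
\<close>

definition state_pairs :: "('x::real_normed_vector \<times> ('x \<Rightarrow>\<^sub>L real)) set" where
  "state_pairs = {(x, x'). x \<in> sphere 0 1 \<and> x' \<in> sphere 0 1 \<and> blinfun_apply x' x = 1}"

definition numerical_radius :: "('x::real_normed_vector \<Rightarrow>\<^sub>L 'x) \<Rightarrow> real" where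
  "numerical_radius T = (SUP (x, x') \<in> state_pairs. \<bar>blinfun_apply x' (blinfun_apply T x)\<bar>)"

definition BPBp_numerical_radius :: "'x::real_normed_vector itself \<Rightarrow> bool" where
  "BPBp_numerical_radius _ \<longleftrightarrow>
     (\<exists>\<delta> :: real \<Rightarrow> real. (\<forall>\<epsilon>. 0 < \<epsilon> \<and> \<epsilon> < 1 \<longrightarrow> 0 < \<delta> \<epsilon> \<and> \<delta> \<epsilon> < 1) \<and>
        (\<forall>\<epsilon> (T :: 'x \<Rightarrow>\<^sub>L 'x) x x'.
           0 < \<epsilon> \<and> \<epsilon> < 1 \<and> numerical_radius T = 1 \<and> (x, x') \<in> state_pairs \<and>
           blinfun_apply x' (blinfun_apply T x) \<ge> 1 - \<delta> \<epsilon> \<longrightarrow>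
           (\<exists>(T0 :: 'x \<Rightarrow>\<^sub>L 'x) x0 x0'.
              numerical_radius T0 = 1 \<and> (x0, x0') \<in> state_pairs \<and>
              blinfun_apply x0' (blinfun_apply T0 x0) = 1 \<and>
              numerical_radius (T - T0) \<le> \<epsilon> \<and> norm (x - x0) \<le> \<epsilon> \<and> norm (x' - x0') \<le> \<epsilon>)))"

end

theory Submission
  imports Defs
begin

text \<open>
  A regular measure on \<open>A(\<Gamma>)\<close> is a summable family \<open>a\<close>, and an operator on \<open>C(A(\<Gamma>))\<close> is a bounded
  family of such rows \<open>a t\<close>, subject to a continuity condition at \<open>\<infinity>\<close> only: the coordinates at the points
  of \<open>\<Gamma>\<close> and the total sum converge as \<open>t \<rightarrow> \<infinity>\<close>. All rows but the one at \<open>\<infinity>\<close> can therefore be chosen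
  freely, up to an asymptotic condition.

  For the BPB property, let \<open>x'\<close> be given by the family \<open>m\<close>. Then \<open>m\<close> is close to a normalized family
  \<open>m0\<close> with finite support \<open>A\<close> such that \<open>x t * T x t\<close> is almost \<open>1\<close> for \<open>t \<in> A\<close>. For these \<open>t\<close>, the row
  of \<open>T\<close> is close to a normalized row that attains its norm at the function \<open>x0\<close> obtained by clipping a
  multiple of \<open>x\<close> to \<open>[-1,1]\<close>. The finitely many rows in \<open>A\<close> are replaced. If \<open>\<infinity> \<in> A\<close>, this
  changes the limit of the rows, and the nearby rows are adapted by compensation without exceeding norm \<open>1\<close>.
\<close>

section \<open>Summable families\<close>

text \<open>The obstacle is mass that escapes to infinity. Unit masses of opposite sign at two
  points moving to infinity disappear from the total and from every fixed coordinate, yet enlarge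
  the norm and the positive part; so the factor of the proportional \<open>compensate\<close> can
  jump in the limit. In \<open>replace_row_at_infinity\<close> the compensated part tends to 0 at
  every isolated point, and there the proportional choice is continuous. A general family gets
  \<open>compensate_above\<close>, which prefers the isolated points. A compensation is nonnegative,
  so a new row at infinity must have a nonnegative coordinate there; this sign comes from attaining
  the value \<open>x pt_inf\<close>, which is then 1 or -1. Constants:
  \<open>normalized_truncation\<close> with loss \<open>\<eta>\<close> and tolerance
  \<open>e\<close> costs \<open>5 * \<eta> / e\<close>. For the functional, loss
  \<open>\<epsilon> ^ 3 / 100\<close> and tolerance \<open>\<epsilon>\<^sup>2 / 20\<close> cost
  \<open>\<epsilon>\<close>; for a row, loss \<open>\<epsilon>\<^sup>2 / 20\<close> and tolerance
  \<open>\<epsilon>\<close> cost \<open>\<epsilon> / 4\<close>, because replacing the row at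
  infinity multiplies the error by 4.\<close>

abbreviation l1 :: "('a \<Rightarrow> real) \<Rightarrow> bool" where
  "l1 a \<equiv> integrable (count_space UNIV) a"

abbreviation tot :: "('a \<Rightarrow> real) \<Rightarrow> real" where
  "tot a \<equiv> integral\<^sup>L (count_space UNIV) a"

lemma l1_bound:
  assumes "l1 b" "\<And>s. \<bar>a s\<bar> \<le> b s"
  shows "l1 a"
  by (rule Bochner_Integration.integrable_bound[OF assms(1)]) (auto intro: order_trans[OF assms(2)] abs_ge_self)

lemma l1_mult_bounded:
  assumes "l1 a" "\<And>s. \<bar>f s\<bar> \<le> C"
  shows "l1 (\<lambda>s. a s * f s)"
proof (rule l1_bound)
  show "l1 (\<lambda>s. \<bar>a s\<bar> * C)" using assms by simp
  show "\<bar>a s * f s\<bar> \<le> \<bar>a s\<bar> * C" for s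
    using assms(2)[of s] by (simp add: abs_mult mult_left_mono)
qed

lemma l1_indicator [simp, intro]: "l1 a \<Longrightarrow> l1 (\<lambda>s. indicator A s * a s)"
  by (rule l1_bound[of "\<lambda>s. \<bar>a s\<bar>"]) (auto split: split_indicator)

lemma l1_finite_support:
  assumes "finite D" "\<And>s. s \<notin> D \<Longrightarrow> a s = 0"
  shows "l1 a" and "tot a = sum a D"
proof -
  have "l1 (\<lambda>s. \<Sum>d\<in>D. a d * indicator {d} s)"
    by (intro Bochner_Integration.integrable_sum) auto
  moreover have "(\<lambda>s. \<Sum>d\<in>D. a d * indicator {d} s) = a"
  proof
    fix s
    have "(\<Sum>d\<in>D. a d * indicator {d} s) = (\<Sum>d\<in>D. if d = s then a s else 0)"
      by (intro sum.cong) auto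
    then show "(\<Sum>d\<in>D. a d * indicator {d} s) = a s"
      using assms by (cases "s \<in> D") (auto simp: sum.delta)
  qed
  ultimately show "l1 a" by simp
  have "tot a = sum a {s. a s \<noteq> 0}"
    using lebesgue_integral_count_space_finite_support[of UNIV a] assms finite_subset[of "{s. a s \<noteq> 0}" D]
    by auto
  also have "\<dots> = sum a D"
    using assms by (intro sum.mono_neutral_left) auto
  finally show "tot a = sum a D" .
qed

lemma tot_single: "tot (\<lambda>s. if s = u then c else 0) = (c::real)"
  and l1_single: "l1 (\<lambda>s. if s = u then c else 0)"
  using l1_finite_support[of "{u}" "\<lambda>s. if s = u then c else 0"] by auto

lemma tot_split_finite:
  assumes "l1 a" "finite D"
  shows "tot a = sum a D + tot (\<lambda>s. indicator (-D) s * a s)"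
proof -
  have "tot (\<lambda>s. indicator D s * a s) = sum (\<lambda>s. indicator D s * a s) D"
    using assms(2) by (intro l1_finite_support) auto
  also have "\<dots> = sum a D" by (intro sum.cong) auto
  finally have 1: "tot (\<lambda>s. indicator D s * a s) = sum a D" .
  have "tot a = tot (\<lambda>s. indicator D s * a s + indicator (-D) s * a s)"
    by (intro Bochner_Integration.integral_cong) (auto split: split_indicator)
  also have "\<dots> = tot (\<lambda>s. indicator D s * a s) + tot (\<lambda>s. indicator (-D) s * a s)"
    using assms by (intro Bochner_Integration.integral_add) auto
  finally show ?thesis using 1 by simp
qed

lemma tot_mono:
  assumes "l1 a" "l1 b" "\<And>s. a s \<le> b s"
  shows "tot a \<le> tot b"
  using assms by (intro integral_mono) auto

lemma tot_abs: "l1 a \<Longrightarrow> \<bar>tot a\<bar> \<le> tot (\<lambda>s. \<bar>a s\<bar>)"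
  by (rule integral_abs_bound)

lemma abs_le_tot:
  assumes "l1 a" shows "\<bar>a s\<bar> \<le> tot (\<lambda>s. \<bar>a s\<bar>)"
proof -
  have "\<bar>a s\<bar> = tot (\<lambda>t. if t = s then \<bar>a s\<bar> else 0)" by (simp add: tot_single)
  also have "\<dots> \<le> tot (\<lambda>s. \<bar>a s\<bar>)"
    using assms by (intro tot_mono l1_single) auto
  finally show ?thesis .
qed

lemma tot_mult_bound:
  assumes "l1 a" "\<And>s. \<bar>f s\<bar> \<le> C"
  shows "\<bar>tot (\<lambda>s. a s * f s)\<bar> \<le> tot (\<lambda>s. \<bar>a s\<bar>) * C"
proof -
  have "\<bar>tot (\<lambda>s. a s * f s)\<bar> \<le> tot (\<lambda>s. \<bar>a s * f s\<bar>)"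
    by (rule integral_abs_bound)
  also have "\<dots> \<le> tot (\<lambda>s. \<bar>a s\<bar> * C)"
    using assms(1) assms(2) integrable_abs[OF l1_mult_bounded[OF assms]]
    by (intro tot_mono) (auto simp: abs_mult intro!: mult_left_mono)
  finally show ?thesis by simp
qed

text \<open>Links two views of a summable family: integrals give linearity and monotonicity,
  unordered sums give approximation by finite sets.\<close>

lemma l1_iff_summable_on: "l1 a \<longleftrightarrow> a summable_on UNIV"
  by (metis Infinite_Set_Sum.abs_summable_on_def abs_summable_equivalent
      summable_on_iff_abs_summable_on_real)

lemma tot_eq_infsum: "l1 a \<Longrightarrow> tot a = infsum a UNIV"
  by (metis Infinite_Set_Sum.abs_summable_on_def infsetsum_def infsetsum_infsum)

lemma l1_tail:
  assumes "l1 a" "e > 0"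
  obtains D where "finite D" "tot (\<lambda>s. indicator (-D) s * \<bar>a s\<bar>) < e"
proof -
  have l: "l1 (\<lambda>s. \<bar>a s\<bar>)" using assms by simp
  obtain D where D: "finite D" "dist (sum (\<lambda>s. \<bar>a s\<bar>) D) (tot (\<lambda>s. \<bar>a s\<bar>)) \<le> e/2"
    using infsum_finite_approximation[of "\<lambda>s. \<bar>a s\<bar>" UNIV "e/2"] l assms(2)
    by (auto simp: l1_iff_summable_on tot_eq_infsum)
  show ?thesis
    using that[OF D(1)] tot_split_finite[OF l D(1)] D(2) assms(2) by (simp add: dist_real_def)
qed

lemma l1_finite_sums:
  assumes "\<And>D. finite D \<Longrightarrow> D \<subseteq> A \<Longrightarrow> (\<Sum>s\<in>D. \<bar>a s\<bar>) \<le> C"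
  shows "l1 (\<lambda>s. indicator A s * a s)"
proof -
  have "(\<lambda>s. \<bar>a s\<bar>) summable_on A"
    by (intro nonneg_bdd_above_summable_on) (auto intro!: bdd_aboveI2 assms)
  then have "a summable_on A" by (subst summable_on_iff_abs_summable_on_real) simp
  then have "(\<lambda>s. indicator A s * a s) summable_on UNIV"
    by (subst summable_on_cong_neutral[where T = A and g = a]) auto
  then show ?thesis by (simp add: l1_iff_summable_on)
qed

section \<open>The one-point compactification\<close>

definition pt_inf :: "'g one_point" where
  "pt_inf = one_point_of_option None"

lemma option_of_one_point_pt_inf [simp]: "option_of_one_point pt_inf = None"
  by (simp add: pt_inf_def one_point_of_option_inverse)

lemma option_of_one_point_eq_None [simp]: "option_of_one_point t = None \<longleftrightarrow> t = pt_inf"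
  by (metis option_of_one_point_inject option_of_one_point_pt_inf)

lemma open_one_point_iff: "open U \<longleftrightarrow> pt_inf \<notin> U \<or> finite (-U)" for U :: "'g one_point set"
proof -
  let ?o = "option_of_one_point :: 'g one_point \<Rightarrow> _"
  have bij: "bij ?o"
    by (metis bijI' option_of_one_point_inject one_point_of_option_inverse UNIV_I)
  have compl: "?o ` (-U) = - ?o ` U" using bij by (rule bij_image_Compl_eq)
  have 1: "(\<exists>V. ?o ` U = Some ` V) \<longleftrightarrow> None \<notin> ?o ` U"
  proof
    assume "None \<notin> ?o ` U"
    then have "?o ` U \<subseteq> range Some" by (metis not_None_eq rangeI subsetI)
    then show "\<exists>V. ?o ` U = Some ` V" by (meson subset_imageE)
  qed auto
  have 2: "(\<exists>C. finite C \<and> ?o ` U = insert None (Some ` (UNIV - C))) \<longleftrightarrow> None \<in> ?o ` U \<and> finite (- ?o ` U)"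
  proof
    assume "\<exists>C. finite C \<and> ?o ` U = insert None (Some ` (UNIV - C))"
    then obtain C where C: "finite C" "?o ` U = insert None (Some ` (UNIV - C))" by blast
    then have "- ?o ` U \<subseteq> Some ` C" by (auto simp: image_iff)
    then show "None \<in> ?o ` U \<and> finite (- ?o ` U)"
      using C finite_subset[OF _ finite_imageI[OF C(1)]] by auto
  next
    assume R: "None \<in> ?o ` U \<and> finite (- ?o ` U)"
    define C where "C = Some -` (- ?o ` U)"
    have "?o ` U = insert None (Some ` (UNIV - C))"
    proof (rule set_eqI)
      show "x \<in> ?o ` U \<longleftrightarrow> x \<in> insert None (Some ` (UNIV - C))" for x
        using R by (cases x) (auto simp: C_def)
    qed
    moreover have "finite C" unfolding C_def using R by (intro finite_vimageI) auto
    ultimately show "\<exists>C. finite C \<and> ?o ` U = insert None (Some ` (UNIV - C))" by blast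
  qed
  have 3: "None \<in> ?o ` U \<longleftrightarrow> pt_inf \<in> U"
    by (metis image_iff option_of_one_point_eq_None)
  have 4: "finite (- ?o ` U) \<longleftrightarrow> finite (-U)"
    unfolding compl[symmetric] by (intro finite_image_iff inj_on_subset[OF bij_is_inj[OF bij]]) simp
  show ?thesis
    unfolding open_one_point_def openin_Alexandroff_compactification
    using 1 2 3 4 by (auto simp: compactin_discrete_topology)
qed

text \<open>If \<open>'g\<close> is finite, both filters are trivial and every limit at
  \<open>pt_inf\<close> holds vacuously, so this case is covered by the same arguments.\<close>

lemma at_pt_inf: "at (pt_inf :: 'g one_point) = cofinite"
proof (rule filter_eqI)
  fix P :: "'g one_point \<Rightarrow> bool"
  show "eventually P (at pt_inf) \<longleftrightarrow> eventually P cofinite"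
  proof
    assume "eventually P (at pt_inf)"
    then obtain S where S: "finite (-S)" "pt_inf \<in> S" "\<forall>y\<in>S. y \<noteq> pt_inf \<longrightarrow> P y"
      unfolding eventually_at_topological open_one_point_iff by blast
    then have "{x. \<not> P x} \<subseteq> insert pt_inf (-S)" by auto
    then show "eventually P cofinite"
      using S(1) by (auto simp: eventually_cofinite intro: finite_subset)
  next
    assume *: "eventually P cofinite"
    have "- insert pt_inf {x. P x} \<subseteq> {x. \<not> P x}" by auto
    then have "open (insert pt_inf {x. P x})"
      using * unfolding open_one_point_iff eventually_cofinite by (auto intro: finite_subset)
    then show "eventually P (at pt_inf)"
      unfolding eventually_at_topological by blast
  qed
qed

lemma continuous_on_one_point_iff:
  fixes f :: "'g one_point \<Rightarrow> 'b::topological_space"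
  shows "continuous_on UNIV f \<longleftrightarrow> (f \<longlongrightarrow> f pt_inf) cofinite"
proof -
  have "isCont f t" if "t \<noteq> pt_inf" for t
  proof -
    have "open {t}" using that by (simp add: open_one_point_iff)
    then have "at t = bot" by (simp add: at_eq_bot_iff)
    then show ?thesis by (simp add: isCont_def)
  qed
  moreover have "isCont f pt_inf \<longleftrightarrow> (f \<longlongrightarrow> f pt_inf) cofinite"
    unfolding isCont_def unfolding at_pt_inf by (rule refl)
  ultimately show ?thesis
    by (metis UNIV_I continuous_on_eq_continuous_at open_UNIV)
qed

text \<open>Each set is closed or open, according to whether it contains
  \<open>pt_inf\<close>.\<close>

lemma sets_borel_one_point [simp]: "sets (borel :: 'g one_point measure) = UNIV"
proof -
  have "A \<in> sets borel" for A :: "'g one_point set"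
  proof (cases "pt_inf \<in> A")
    case True
    then have "open (-A)" by (simp add: open_one_point_iff)
    then have "- (-A) \<in> sets borel" by (intro borel_comp borel_open)
    then show ?thesis by simp
  next
    case False
    then show ?thesis by (intro borel_open) (simp add: open_one_point_iff)
  qed
  then show ?thesis by auto
qed

lemma apply_Bcontfun_one_point:
  fixes f :: "'g one_point \<Rightarrow> real"
  assumes "(f \<longlongrightarrow> f pt_inf) cofinite"
  shows "apply_bcontfun (Bcontfun f) = f"
proof -
  have c: "continuous_on UNIV f" using assms by (simp add: continuous_on_one_point_iff)
  have "bounded (range f)"
    using compact_continuous_image[OF c compact_UNIV_space] by (rule compact_imp_bounded)
  then show ?thesis using c by (simp add: Bcontfun_inverse bcontfun_def)
qed

lemma bcontfun_tendsto_pt_inf: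
  fixes f :: "'g one_point \<Rightarrow>\<^sub>C real"
  shows "(apply_bcontfun f \<longlongrightarrow> f pt_inf) cofinite"
  by (simp flip: continuous_on_one_point_iff)

lemma norm_bcontfun_le_iff:
  fixes f :: "'g one_point \<Rightarrow>\<^sub>C real"
  shows "norm f \<le> C \<longleftrightarrow> (\<forall>t. \<bar>f t\<bar> \<le> C)"
  using norm_bounded[of f] norm_bound[of f C] by (auto intro: order_trans)

text \<open>On a bounded set of summable families, the weak* topology is determined by the total sum and by
  the coordinates at the isolated points.\<close>

lemma tot_mult_tendsto:
  fixes a :: "'i \<Rightarrow> 'g one_point \<Rightarrow> real" and f :: "'g one_point \<Rightarrow> real"
  assumes l: "\<And>t. l1 (a t)" "\<And>t. tot (\<lambda>s. \<bar>a t s\<bar>) \<le> C" and lb: "l1 b"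
    and lim_tot: "((\<lambda>t. tot (a t)) \<longlongrightarrow> tot b) F"
    and lim_coord: "\<And>s. s \<noteq> pt_inf \<Longrightarrow> ((\<lambda>t. a t s) \<longlongrightarrow> b s) F"
    and f: "(f \<longlongrightarrow> f pt_inf) cofinite"
  shows "((\<lambda>t. tot (\<lambda>s. a t s * f s)) \<longlongrightarrow> tot (\<lambda>s. b s * f s)) F"
proof (rule tendstoI)
  fix e :: real assume "e > 0"
  define c where "c = f pt_inf"
  \<comment> \<open>The summand 1 keeps \<open>C'\<close> positive; it also turns the final bound
    into \<open>(C' - 1) * d = e / 2 - d\<close>, which makes it strict.\<close>
  define C' where "C' = \<bar>C\<bar> + tot (\<lambda>s. \<bar>b s\<bar>) + 1"
  have C': "C' > 0" unfolding C'_def by (smt (verit) Bochner_Integration.integral_nonneg)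
  define d where "d = e / (2 * C')"
  have d: "d > 0" using C' \<open>e > 0\<close> by (simp add: d_def)
  define H where "H = {s. \<not> dist (f s) c < d}"
  have finH: "finite H"
    using tendstoD[OF f d] by (simp add: eventually_cofinite H_def c_def)
  have infH: "pt_inf \<notin> H" using d by (simp add: H_def c_def)
  define g where "g = (\<lambda>s. indicator (-H) s * (f s - c))"
  have g: "\<bar>g s\<bar> \<le> d" for s using d by (auto simp: g_def H_def dist_real_def split: split_indicator)
  \<comment> \<open>Only finitely many values of \<open>f\<close> differ from
    \<open>f pt_inf\<close> by \<open>d\<close> or more. So the pairing with \<open>f\<close> is a
    multiple of the total plus finitely many coordinates at isolated points, up to an error
    proportional to \<open>d\<close>.\<close>
  have split: "tot (\<lambda>s. x s * f s) = c * tot x + (\<Sum>s\<in>H. x s * (f s - c)) + tot (\<lambda>s. x s * g s)"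
    if x: "l1 x" for x
  proof -
    have h: "tot (\<lambda>s. indicator H s * (x s * (f s - c))) = (\<Sum>s\<in>H. x s * (f s - c))"
      and lh: "l1 (\<lambda>s. indicator H s * (x s * (f s - c)))"
      using l1_finite_support[OF finH, of "\<lambda>s. indicator H s * (x s * (f s - c))"] by auto
    have "tot (\<lambda>s. x s * f s) = tot (\<lambda>s. c * x s + indicator H s * (x s * (f s - c)) + x s * g s)"
      by (intro Bochner_Integration.integral_cong) (auto simp: g_def algebra_simps split: split_indicator)
    then show ?thesis
      using x lh l1_mult_bounded[OF x g] by (simp add: h)
  qed
  define p where "p = (\<lambda>x::'g one_point \<Rightarrow> real. c * tot x + (\<Sum>s\<in>H. x s * (f s - c)))"
  have err: "\<bar>tot (\<lambda>s. x s * f s) - p x\<bar> \<le> tot (\<lambda>s. \<bar>x s\<bar>) * d" if "l1 x" for x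
    using split[OF that] tot_mult_bound[OF that g] by (simp add: p_def)
  have "((\<lambda>t. p (a t)) \<longlongrightarrow> p b) F"
    unfolding p_def by (intro tendsto_intros lim_tot lim_coord) (use infH in auto)
  then have "\<forall>\<^sub>F t in F. dist (p (a t)) (p b) < e / 2"
    by (rule tendstoD) (use \<open>e > 0\<close> in simp)
  then show "\<forall>\<^sub>F t in F. dist (tot (\<lambda>s. a t s * f s)) (tot (\<lambda>s. b s * f s)) < e"
  proof (rule eventually_mono)
    fix t assume *: "dist (p (a t)) (p b) < e / 2"
    have "tot (\<lambda>s. \<bar>a t s\<bar>) * d + tot (\<lambda>s. \<bar>b s\<bar>) * d = (tot (\<lambda>s. \<bar>a t s\<bar>) + tot (\<lambda>s. \<bar>b s\<bar>)) * d"
      by (simp add: algebra_simps)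
    also have "\<dots> \<le> (C' - 1) * d"
      using l(2)[of t] d by (intro mult_right_mono) (auto simp: C'_def)
    also have "\<dots> = e / 2 - d" using C' by (simp add: d_def field_simps)
    finally have "tot (\<lambda>s. \<bar>a t s\<bar>) * d + tot (\<lambda>s. \<bar>b s\<bar>) * d < e / 2" using d by simp
    then show "dist (tot (\<lambda>s. a t s * f s)) (tot (\<lambda>s. b s * f s)) < e"
      using err[OF l(1), of t] err[OF lb] * unfolding dist_real_def by linarith
  qed
qed

lemma coordinate_tendsto:
  fixes a :: "'i \<Rightarrow> 'g one_point \<Rightarrow> real"
  assumes lim: "\<And>f. (f \<longlongrightarrow> f pt_inf) cofinite \<Longrightarrow>
      ((\<lambda>t. tot (\<lambda>s. a t s * f s)) \<longlongrightarrow> tot (\<lambda>s. b s * f s)) F"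
    and u: "u \<noteq> pt_inf"
  shows "((\<lambda>t. a t u) \<longlongrightarrow> b u) F"
proof -
  have "tot (\<lambda>s. x s * (if s = u then 1 else 0)) = x u" for x :: "'g one_point \<Rightarrow> real"
    using tot_single[of u "x u"] by (simp add: if_distrib[of "(*) _"] cong: if_cong)
  moreover have "((\<lambda>s. if s = u then 1 else 0 :: real) \<longlongrightarrow> (if pt_inf = u then 1 else 0)) cofinite"
    by (rule tendsto_eventually) (use u in \<open>auto simp: eventually_cofinite\<close>)
  ultimately show ?thesis using lim[of "\<lambda>s. if s = u then 1 else 0"] by simp
qed

section \<open>Signed Borel measures\<close>

lemma borel_signed_measure_empty:
  assumes "borel_signed_measure \<mu>"
  shows "\<mu> {} = 0"
proof -
  have "(\<lambda>n. \<mu> ((\<lambda>_. {}) n)) sums \<mu> (\<Union>n::nat. (\<lambda>_. {}) n)"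
    using assms unfolding borel_signed_measure_def by (auto simp: disjoint_family_on_def)
  then have "summable (\<lambda>n::nat. \<mu> {})" by (auto simp: summable_def)
  then show ?thesis by (simp only: summable_const_iff)
qed

lemma borel_signed_measure_Un:
  assumes \<mu>: "borel_signed_measure \<mu>"
    and AB: "A \<in> sets borel" "B \<in> sets borel" "A \<inter> B = {}"
  shows "\<mu> (A \<union> B) = \<mu> A + \<mu> B"
proof -
  have "(\<lambda>n. \<mu> (binaryset A B n)) sums \<mu> (\<Union>n. binaryset A B n)"
  proof -
    have "disjoint_family (binaryset A B)"
      using AB(3) by (auto simp: disjoint_family_on_def binaryset_def)
    moreover have "range (binaryset A B) \<subseteq> sets borel"
      using AB(1,2) by (simp add: range_binaryset_eq)
    ultimately show ?thesis using \<mu> unfolding borel_signed_measure_def by blast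
  qed
  moreover have "(\<lambda>n. \<mu> (binaryset A B n)) sums (\<mu> A + \<mu> B)"
    using borel_signed_measure_empty[OF \<mu>] by (rule binaryset_sums)
  ultimately show ?thesis by (simp add: UN_binaryset_eq sums_unique2)
qed

lemma borel_signed_measure_Diff:
  assumes "borel_signed_measure \<mu>" "A \<in> sets borel" "B \<in> sets borel" "B \<subseteq> A"
  shows "\<mu> (A - B) = \<mu> A - \<mu> B"
proof -
  have "\<mu> (A - B \<union> B) = \<mu> (A - B) + \<mu> B"
    using assms by (intro borel_signed_measure_Un) auto
  moreover have "A - B \<union> B = A" using assms(4) by blast
  ultimately show ?thesis by simp
qed

lemma borel_signed_measure_Union:
  assumes \<mu>: "borel_signed_measure \<mu>" and "finite P" "P \<subseteq> sets borel" "disjoint P"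
  shows "\<mu> (\<Union>P) = (\<Sum>B\<in>P. \<mu> B)"
  using assms(2-)
proof (induction P rule: finite_induct)
  case empty
  then show ?case using borel_signed_measure_empty[OF \<mu>] by simp
next
  case (insert B P)
  have "B \<inter> \<Union>P = {}"
    using insert.prems insert.hyps by (fastforce simp: disjoint_def)
  moreover have "\<Union>P \<in> sets borel"
    using insert by (intro sets.finite_Union) auto
  ultimately have "\<mu> (B \<union> \<Union>P) = \<mu> B + \<mu> (\<Union>P)"
    using insert.prems by (intro borel_signed_measure_Un[OF \<mu>]) auto
  moreover have "disjoint P" using insert.prems by (auto simp: disjoint_def)
  ultimately show ?case using insert by simp
qed

text \<open>If \<open>\<mu>\<close> is unbounded on the subsets of \<open>E\<close>, then one can split off a set \<open>A\<close> with \<open>\<bar>\<mu> A\<bar> > 1\<close>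
  such that \<open>\<mu>\<close> remains unbounded on the subsets of \<open>E - A\<close>. Iterating this produces a disjoint
  sequence that contradicts countable additivity.\<close>

lemma borel_signed_measure_bounded:
  fixes \<mu> :: "'k::topological_space set \<Rightarrow> real"
  assumes \<mu>: "borel_signed_measure \<mu>"
  obtains c where "\<And>A. A \<in> sets borel \<Longrightarrow> \<bar>\<mu> A\<bar> \<le> c"
proof (rule ccontr)
  assume neg: "\<not> thesis"
  define U where
    "U = (\<lambda>E. E \<in> sets borel \<and> (\<forall>c. \<exists>B\<in>sets borel. B \<subseteq> E \<and> \<bar>\<mu> B\<bar> > c))"
  have U0: "U UNIV"
    using neg that unfolding U_def by (auto simp: not_le) (meson linorder_not_less)
  have step: "\<exists>E'. U E' \<and> (E' \<subseteq> E \<and> \<bar>\<mu> (E - E')\<bar> > 1)" if E: "U E" for E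
  proof -
    obtain B where B: "B \<in> sets borel" "B \<subseteq> E" "\<bar>\<mu> B\<bar> > 1 + \<bar>\<mu> E\<bar>"
      using E unfolding U_def by blast
    have Eb: "E \<in> sets borel" using E by (simp add: U_def)
    have EB: "\<mu> (E - B) = \<mu> E - \<mu> B"
      using borel_signed_measure_Diff[OF \<mu> Eb B(1,2)] .
    have "U (E - B) \<or> U B"
    proof (rule ccontr)
      assume "\<not> (U (E - B) \<or> U B)"
      then obtain c d where
        c: "\<And>C. C \<in> sets borel \<Longrightarrow> C \<subseteq> E - B \<Longrightarrow> \<bar>\<mu> C\<bar> \<le> c" and
        d: "\<And>C. C \<in> sets borel \<Longrightarrow> C \<subseteq> B \<Longrightarrow> \<bar>\<mu> C\<bar> \<le> d"
        unfolding U_def using B(1) sets.Diff[OF Eb B(1)] not_le by metis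
      obtain C where C: "C \<in> sets borel" "C \<subseteq> E" "\<bar>\<mu> C\<bar> > c + d"
        using E unfolding U_def by blast
      have "\<mu> (C - B) = \<mu> C - \<mu> (C \<inter> B)"
        using borel_signed_measure_Diff[OF \<mu>, of C "C \<inter> B"] B C by (auto simp: Diff_Int)
      moreover have "\<bar>\<mu> (C - B)\<bar> \<le> c" using B C by (intro c) auto
      moreover have "\<bar>\<mu> (C \<inter> B)\<bar> \<le> d" using B C by (intro d) auto
      ultimately show False using C(3) by linarith
    qed
    then show ?thesis
    proof
      assume *: "U (E - B)"
      have "E - (E - B) = B" using B by auto
      then show ?thesis using * B by (intro exI[of _ "E - B"]) auto
    next
      assume "U B"
      then show ?thesis using B EB by (intro exI[of _ B]) auto
    qed
  qed
  obtain E where E: "\<And>n. U (E n)" "\<And>n. E (Suc n) \<subseteq> E n" "\<And>n. \<bar>\<mu> (E n - E (Suc n))\<bar> > 1"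
    using dependent_nat_choice[of "\<lambda>_. U" "\<lambda>_ E E'. E' \<subseteq> E \<and> \<bar>\<mu> (E - E')\<bar> > 1"] U0 step by metis
  have dec: "E n \<subseteq> E m" if "m \<le> n" for m n
    using lift_Suc_antimono_le[of E, OF E(2) that] .
  have "(\<lambda>n. \<mu> (E n - E (Suc n))) sums \<mu> (\<Union>n. E n - E (Suc n))"
  proof -
    have "disjoint_family (\<lambda>n. E n - E (Suc n))"
      unfolding disjoint_family_on_def
    proof (intro ballI impI)
      fix m n :: nat assume "m \<noteq> n"
      then show "(E m - E (Suc m)) \<inter> (E n - E (Suc n)) = {}"
        using dec[of "Suc m" n] dec[of "Suc n" m] by (cases "m < n") auto
    qed
    moreover have "range (\<lambda>n. E n - E (Suc n)) \<subseteq> sets borel"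
      using E(1) by (auto simp: U_def)
    ultimately show ?thesis using \<mu> unfolding borel_signed_measure_def by auto
  qed
  then have "(\<lambda>n. \<mu> (E n - E (Suc n))) \<longlonglongrightarrow> 0"
    by (intro summable_LIMSEQ_zero) (rule sums_summable)
  from LIMSEQ_D[OF this, of 1] obtain n where "\<bar>\<mu> (E n - E (Suc n))\<bar> < 1" by auto
  with E(3)[of n] show False by simp
qed

text \<open>Grouping the sets of a partition by the sign of \<open>\<mu>\<close> gives two unions,
  each of measure at most \<open>c\<close> in modulus. The bound makes the supremum in
  \<open>total_variation\<close> meaningful.\<close>

lemma bdd_above_partition_sums:
  assumes \<mu>: "borel_signed_measure \<mu>"
  shows "bdd_above ((\<lambda>P. \<Sum>B\<in>P. \<bar>\<mu> B\<bar>) ` {P. finite P \<and> P \<subseteq> sets borel \<and> disjoint P \<and> \<Union>P = A})"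
proof -
  obtain c where c: "\<And>A. A \<in> sets borel \<Longrightarrow> \<bar>\<mu> A\<bar> \<le> c"
    using borel_signed_measure_bounded[OF \<mu>] by blast
  show ?thesis
  proof (rule bdd_aboveI2)
    fix P assume P: "P \<in> {P. finite P \<and> P \<subseteq> sets borel \<and> disjoint P \<and> \<Union>P = A}"
    let ?Q = "{B\<in>P. \<mu> B \<ge> 0}" and ?R = "{B\<in>P. \<not> \<mu> B \<ge> 0}"
    have "(\<Sum>B\<in>P. \<bar>\<mu> B\<bar>) = (\<Sum>B\<in>?Q. \<bar>\<mu> B\<bar>) + (\<Sum>B\<in>?R. \<bar>\<mu> B\<bar>)"
      using P by (subst sum.union_disjoint[symmetric]) (auto intro!: sum.cong)
    also have "\<dots> = (\<Sum>B\<in>?Q. \<mu> B) - (\<Sum>B\<in>?R. \<mu> B)"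
      by (simp add: sum_negf[symmetric])
    also have "\<dots> = \<mu> (\<Union>?Q) - \<mu> (\<Union>?R)"
      using P by (subst (1 2) borel_signed_measure_Union[OF \<mu>]) (auto simp: disjoint_def)
    also have "\<dots> \<le> c + c"
    proof -
      have "\<Union>?Q \<in> sets borel" "\<Union>?R \<in> sets borel"
        using P by (auto intro!: sets.finite_Union)
      from c[OF this(1)] c[OF this(2)] show ?thesis by linarith
    qed
    finally show "(\<Sum>B\<in>P. \<bar>\<mu> B\<bar>) \<le> c + c" .
  qed
qed

lemma partition_sum_le_total_variation:
  assumes "borel_signed_measure \<mu>" "finite P" "P \<subseteq> sets borel" "disjoint P" "\<Union>P = A"
  shows "(\<Sum>B\<in>P. \<bar>\<mu> B\<bar>) \<le> total_variation \<mu> A"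
  unfolding total_variation_def
  using assms by (intro cSUP_upper bdd_above_partition_sums) auto

lemma abs_le_total_variation:
  assumes "borel_signed_measure \<mu>" "A \<in> sets borel" "B \<in> sets borel" "B \<subseteq> A"
  shows "\<bar>\<mu> B\<bar> \<le> total_variation \<mu> A"
proof -
  have "\<bar>\<mu> B\<bar> \<le> (\<Sum>B\<in>{B, A - B}. \<bar>\<mu> B\<bar>)"
    by (rule member_le_sum) auto
  also have "\<dots> \<le> total_variation \<mu> A"
    using assms by (intro partition_sum_le_total_variation) (auto simp: disjoint_def)
  finally show ?thesis .
qed

section \<open>Regular measures on the one-point compactification are atomic\<close>

definition atomic_measure :: "('a \<Rightarrow> real) \<Rightarrow> 'a set \<Rightarrow> real" where
  "atomic_measure a A = tot (\<lambda>s. indicator A s * a s)"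

lemma atomic_measure_UNIV [simp]: "atomic_measure a UNIV = tot a"
  by (simp add: atomic_measure_def)

text \<open>Atomicity comes from regularity: a compact set without \<open>pt_inf\<close> is finite,
  so inner regularity approximates any set of isolated points by finite sets. Countable additivity
  by itself does not control uncountable unions of points.\<close>

lemma regular_borel_measure_has_sum:
  fixes \<mu> :: "'g one_point set \<Rightarrow> real"
  assumes \<mu>: "\<mu> \<in> regular_borel_measures"
  shows "((\<lambda>s. \<mu> {s}) has_sum \<mu> A) A"
proof -
  have b: "borel_signed_measure \<mu>" using \<mu> by (simp add: regular_borel_measures_def)
  have fin: "\<mu> Y = (\<Sum>s\<in>Y. \<mu> {s})" if "finite Y" for Y
  proof -
    have "\<mu> (\<Union>((\<lambda>s. {s}) ` Y)) = sum \<mu> ((\<lambda>s. {s}) ` Y)"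
      using that by (intro borel_signed_measure_Union[OF b]) (auto simp: disjoint_def)
    then show ?thesis by (simp add: sum.reindex)
  qed
  have *: "((\<lambda>s. \<mu> {s}) has_sum \<mu> A) A" if A: "pt_inf \<notin> A" for A
    unfolding has_sum_def
  proof (rule tendstoI)
    fix e :: real assume "e > 0"
    moreover have "\<forall>A\<in>UNIV. \<forall>e>0. \<exists>C U. compact C \<and> open U \<and> C \<subseteq> A \<and> A \<subseteq> U \<and> total_variation \<mu> (U - C) < e"
      using \<mu> unfolding regular_borel_measures_def sets_borel_one_point by blast
    ultimately obtain C U where C: "compact C" "C \<subseteq> A" "A \<subseteq> U" "total_variation \<mu> (U - C) < e"
      by (meson UNIV_I)
    have "open (-C)" using compact_imp_closed[OF C(1)] by (rule open_Compl)
    then have finC: "finite C" using C(2) A by (auto simp: open_one_point_iff)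
    show "\<forall>\<^sub>F Y in finite_subsets_at_top A. dist (\<Sum>s\<in>Y. \<mu> {s}) (\<mu> A) < e"
      unfolding eventually_finite_subsets_at_top
    proof (intro exI[of _ C] conjI allI impI finC C(2))
      fix Y assume Y: "finite Y \<and> C \<subseteq> Y \<and> Y \<subseteq> A"
      then have "\<mu> (A - Y) = \<mu> A - \<mu> Y"
        by (intro borel_signed_measure_Diff[OF b]) auto
      then have "\<mu> (A - Y) = \<mu> A - (\<Sum>s\<in>Y. \<mu> {s})"
        using fin[of Y] Y by (simp only:)
      moreover have "\<bar>\<mu> (A - Y)\<bar> \<le> total_variation \<mu> (U - C)"
        using C Y by (intro abs_le_total_variation[OF b]) auto
      ultimately show "dist (\<Sum>s\<in>Y. \<mu> {s}) (\<mu> A) < e"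
        using C(4) by (simp add: dist_real_def)
    qed
  qed
  show ?thesis
  proof (cases "pt_inf \<in> A")
    case True
    then have "\<mu> A = \<mu> {pt_inf} + \<mu> (A - {pt_inf})"
      using borel_signed_measure_Diff[OF b, of A "{pt_inf}"] by simp
    moreover have "((\<lambda>s. \<mu> {s}) has_sum (\<mu> {pt_inf} + \<mu> (A - {pt_inf}))) (insert pt_inf (A - {pt_inf}))"
      using *[of "A - {pt_inf}"] by (intro has_sum_insert) auto
    ultimately show ?thesis using True by (simp add: insert_absorb)
  qed (rule *)
qed

lemma regular_borel_measure_atomic:
  fixes \<mu> :: "'g one_point set \<Rightarrow> real"
  assumes \<mu>: "\<mu> \<in> regular_borel_measures"
  obtains a where "l1 a" "\<mu> = atomic_measure a"
proof
  show l: "l1 (\<lambda>s. \<mu> {s})"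
    using regular_borel_measure_has_sum[OF \<mu>] by (auto simp: l1_iff_summable_on summable_on_def)
  show "\<mu> = atomic_measure (\<lambda>s. \<mu> {s})"
  proof
    fix A
    have "tot (\<lambda>s. indicator A s * \<mu> {s}) = infsum (\<lambda>s. indicator A s * \<mu> {s}) UNIV"
      using l by (intro tot_eq_infsum) auto
    also have "\<dots> = infsum (\<lambda>s. \<mu> {s}) A"
      by (rule infsum_cong_neutral) auto
    also have "\<dots> = \<mu> A"
      using regular_borel_measure_has_sum[OF \<mu>] by (rule infsumI)
    finally show "\<mu> A = atomic_measure (\<lambda>s. \<mu> {s}) A" by (simp add: atomic_measure_def)
  qed
qed

lemma borel_signed_measure_atomic:
  fixes a :: "'g one_point \<Rightarrow> real"
  assumes a: "l1 a"
  shows "borel_signed_measure (atomic_measure a)"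
  unfolding borel_signed_measure_def
proof (intro conjI allI impI)
  fix A :: "nat \<Rightarrow> 'g one_point set" assume dis: "disjoint_family A"
  have "(\<lambda>n. tot (\<lambda>s. indicator (\<Union>i<n. A i) s * a s)) \<longlonglongrightarrow> tot (\<lambda>s. indicator (\<Union>i. A i) s * a s)"
  proof (rule integral_dominated_convergence[where w = "\<lambda>s. \<bar>a s\<bar>"])
    show "AE s in count_space UNIV. (\<lambda>n. indicator (\<Union>i<n. A i) s * a s) \<longlonglongrightarrow> indicator (\<Union>i. A i) s * a s"
      by (intro AE_I2 tendsto_mult LIMSEQ_indicator_UN tendsto_const)
    show "AE s in count_space UNIV. norm (indicator (\<Union>i<n. A i) s * a s) \<le> \<bar>a s\<bar>" for n
      by (auto split: split_indicator)
  qed (use a in auto)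
  moreover have "(\<Sum>i<n. atomic_measure a (A i)) = tot (\<lambda>s. indicator (\<Union>i<n. A i) s * a s)" for n
  proof -
    have "disjoint_family_on A {..<n}" using dis by (auto simp: disjoint_family_on_def)
    then have "(\<lambda>s. indicator (\<Union>i<n. A i) s * a s) = (\<lambda>s. \<Sum>i<n. indicator (A i) s * a s)"
      by (subst indicator_UN_disjoint) (auto simp: sum_distrib_right)
    then have "tot (\<lambda>s. indicator (\<Union>i<n. A i) s * a s) = tot (\<lambda>s. \<Sum>i<n. indicator (A i) s * a s)"
      by (simp only:)
    also have "\<dots> = (\<Sum>i<n. tot (\<lambda>s. indicator (A i) s * a s))"
      using a by (intro Bochner_Integration.integral_sum) auto
    finally show ?thesis by (simp add: atomic_measure_def)
  qed
  ultimately show "(\<lambda>n. atomic_measure a (A n)) sums atomic_measure a (\<Union>n. A n)"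
    unfolding sums_def by (simp add: atomic_measure_def)
qed simp

lemma atomic_measure_mono:
  assumes "l1 a" "l1 b" "A \<subseteq> B" "\<And>s. a s \<le> b s" "\<And>s. 0 \<le> b s"
  shows "atomic_measure a A \<le> atomic_measure b B"
  unfolding atomic_measure_def
  using assms by (intro tot_mono) (auto split: split_indicator)

lemma abs_atomic_measure_le:
  assumes "l1 a" shows "\<bar>atomic_measure a A\<bar> \<le> atomic_measure (\<lambda>s. \<bar>a s\<bar>) A"
  using tot_abs[OF l1_indicator[OF assms, of A]] by (simp add: atomic_measure_def abs_mult)

lemma total_variation_atomic_le:
  fixes a :: "'g one_point \<Rightarrow> real"
  assumes a: "l1 a"
  shows "total_variation (atomic_measure a) A \<le> atomic_measure (\<lambda>s. \<bar>a s\<bar>) A"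
  unfolding total_variation_def
proof (rule cSUP_least)
  show "{P. finite P \<and> P \<subseteq> sets borel \<and> disjoint P \<and> \<Union>P = A} \<noteq> {}"
    by (auto intro!: exI[of _ "{A}"])
  fix P assume P: "P \<in> {P. finite P \<and> P \<subseteq> sets borel \<and> disjoint P \<and> \<Union>P = A}"
  have "(\<Sum>B\<in>P. \<bar>atomic_measure a B\<bar>) \<le> (\<Sum>B\<in>P. atomic_measure (\<lambda>s. \<bar>a s\<bar>) B)"
    by (intro sum_mono abs_atomic_measure_le a)
  also have "\<dots> = atomic_measure (\<lambda>s. \<bar>a s\<bar>) (\<Union>P)"
    using P a by (intro borel_signed_measure_Union[symmetric] borel_signed_measure_atomic) auto
  finally show "(\<Sum>B\<in>P. \<bar>atomic_measure a B\<bar>) \<le> atomic_measure (\<lambda>s. \<bar>a s\<bar>) A" using P by simp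
qed

text \<open>The sign sets \<open>?S\<close> and \<open>-?S\<close> form a Hahn decomposition, and
  this two-set partition already attains the norm.\<close>

lemma total_variation_atomic_UNIV:
  fixes a :: "'g one_point \<Rightarrow> real"
  assumes a: "l1 a"
  shows "total_variation (atomic_measure a) UNIV = tot (\<lambda>s. \<bar>a s\<bar>)"
proof (rule antisym)
  show "total_variation (atomic_measure a) UNIV \<le> tot (\<lambda>s. \<bar>a s\<bar>)"
    using total_variation_atomic_le[OF a, of UNIV] by simp
  let ?S = "{s. a s \<ge> 0}"
  have ne: "?S \<noteq> -?S" by auto
  have "tot (\<lambda>s. \<bar>a s\<bar>) = tot (\<lambda>s. indicator ?S s * a s - indicator (-?S) s * a s)"
    by (intro Bochner_Integration.integral_cong) (auto split: split_indicator)
  also have "\<dots> = atomic_measure a ?S - atomic_measure a (-?S)"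
    using a by (subst Bochner_Integration.integral_diff) (auto simp: atomic_measure_def)
  also have "\<dots> \<le> (\<Sum>B\<in>{?S, -?S}. \<bar>atomic_measure a B\<bar>)"
    using ne by simp
  also have "\<dots> \<le> total_variation (atomic_measure a) UNIV"
    by (intro partition_sum_le_total_variation borel_signed_measure_atomic a) (auto simp: disjoint_def)
  finally show "tot (\<lambda>s. \<bar>a s\<bar>) \<le> total_variation (atomic_measure a) UNIV" .
qed

text \<open>Away from a finite set \<open>D\<close> the variation is small, so it suffices that
  \<open>U - C\<close> avoids \<open>D\<close>: a set containing \<open>pt_inf\<close> is compact
  and is enlarged by \<open>-D\<close>; any other set is open and is cut down to its finite part in
  \<open>D\<close>.\<close>

lemma regular_atomic_measure:
  fixes a :: "'g one_point \<Rightarrow> real"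
  assumes a: "l1 a"
  shows "atomic_measure a \<in> regular_borel_measures"
  unfolding regular_borel_measures_def
proof (intro CollectI conjI ballI allI impI borel_signed_measure_atomic a)
  fix A :: "'g one_point set" and e :: real assume "e > 0"
  then obtain D where D: "finite D" "atomic_measure (\<lambda>s. \<bar>a s\<bar>) (-D) < e"
    using l1_tail[OF a] unfolding atomic_measure_def by metis
  have less: "total_variation (atomic_measure a) B < e" if "B \<subseteq> -D" for B
  proof -
    have "total_variation (atomic_measure a) B \<le> atomic_measure (\<lambda>s. \<bar>a s\<bar>) B"
      by (rule total_variation_atomic_le[OF a])
    also have "\<dots> \<le> atomic_measure (\<lambda>s. \<bar>a s\<bar>) (-D)"
      using a that by (intro atomic_measure_mono) auto
    finally show ?thesis using D by simp
  qed
  show "\<exists>C U. compact C \<and> open U \<and> C \<subseteq> A \<and> A \<subseteq> U \<and> total_variation (atomic_measure a) (U - C) < e"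
  proof (cases "pt_inf \<in> A")
    case True
    then have "closed A" by (simp add: closed_def open_one_point_iff)
    then have "compact A"
      using compact_Int_closed[OF compact_UNIV_space, of A] by simp
    moreover have "open (A \<union> - D)" using True D(1) by (simp add: open_one_point_iff)
    ultimately show ?thesis by (intro exI[of _ A] exI[of _ "A \<union> -D"]) (auto intro!: less)
  next
    case False
    then have "open A" by (simp add: open_one_point_iff)
    moreover have "compact (A \<inter> D)" using D(1) by (intro finite_imp_compact) auto
    ultimately show ?thesis by (intro exI[of _ "A \<inter> D"] exI[of _ A]) (auto intro!: less)
  qed
qed

lemma pos_part_atomic:
  fixes a :: "'g one_point \<Rightarrow> real"
  assumes a: "l1 a"
  shows "pos_part (atomic_measure a) A = atomic_measure (\<lambda>s. max 0 (a s)) A"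
  unfolding pos_part_def
proof (rule cSup_eq_maximum)
  have "atomic_measure (\<lambda>s. max 0 (a s)) A = atomic_measure a (A \<inter> {s. a s > 0})"
    unfolding atomic_measure_def
    by (intro Bochner_Integration.integral_cong) (auto split: split_indicator)
  then show "atomic_measure (\<lambda>s. max 0 (a s)) A \<in> atomic_measure a ` {B \<in> sets borel. B \<subseteq> A}"
    by auto
  show "x \<le> atomic_measure (\<lambda>s. max 0 (a s)) A"
    if "x \<in> atomic_measure a ` {B \<in> sets borel. B \<subseteq> A}" for x
    using that a by (auto intro!: atomic_measure_mono)
qed

lemma neg_part_atomic:
  fixes a :: "'g one_point \<Rightarrow> real"
  assumes a: "l1 a"
  shows "neg_part (atomic_measure a) A = atomic_measure (\<lambda>s. max 0 (- a s)) A"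
proof -
  have "(\<lambda>B. - atomic_measure a B) = atomic_measure (\<lambda>s. - a s)"
    by (simp add: atomic_measure_def fun_eq_iff)
  then show ?thesis using pos_part_atomic[of "\<lambda>s. - a s"] a by (simp add: neg_part_def)
qed

lemma signed_integral_atomic:
  fixes a :: "'g one_point \<Rightarrow> real"
  assumes a: "l1 a" and f: "\<And>s. \<bar>f s\<bar> \<le> C"
  shows "signed_integral (atomic_measure a) f = tot (\<lambda>s. a s * f s)"
proof -
  have *: "integral\<^sup>L (measure_of UNIV (sets borel) (\<lambda>A. ennreal (atomic_measure b A))) f = tot (\<lambda>s. b s * f s)"
    if b: "l1 b" "\<And>s. b s \<ge> 0" for b :: "'g one_point \<Rightarrow> real"
  proof -
    \<comment> \<open>Identifying the \<open>measure_of\<close> term with a density of the counting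
      measure makes its integral a weighted sum.\<close>
    let ?D = "density (count_space UNIV) (\<lambda>s. ennreal (b s))"
    have "emeasure ?D A = ennreal (atomic_measure b A)" for A
    proof -
      have "emeasure ?D A = (\<integral>\<^sup>+s. ennreal (indicator A s * b s) \<partial>count_space UNIV)"
        by (subst emeasure_density) (auto intro!: nn_integral_cong split: split_indicator)
      also have "\<dots> = ennreal (atomic_measure b A)"
        unfolding atomic_measure_def using b by (intro nn_integral_eq_integral) auto
      finally show ?thesis .
    qed
    then have "(\<lambda>A. ennreal (atomic_measure b A)) = emeasure ?D" by auto
    then have "measure_of UNIV (sets borel) (\<lambda>A. ennreal (atomic_measure b A)) = ?D"
      using measure_of_of_measure[of ?D] by simp
    then show ?thesis using b by (simp add: integral_density)
  qed
  have l: "l1 (\<lambda>s. max 0 (a s))" "l1 (\<lambda>s. max 0 (- a s))"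
    using a by auto
  have "signed_integral (atomic_measure a) f = tot (\<lambda>s. max 0 (a s) * f s) - tot (\<lambda>s. max 0 (- a s) * f s)"
    unfolding signed_integral_def pos_part_atomic[OF a] neg_part_atomic[OF a]
    using l by (subst (1 2) *) auto
  also have "\<dots> = tot (\<lambda>s. max 0 (a s) * f s - max 0 (- a s) * f s)"
    using l1_mult_bounded[OF l(1) f] l1_mult_bounded[OF l(2) f] by simp
  also have "\<dots> = tot (\<lambda>s. a s * f s)"
    by (intro Bochner_Integration.integral_cong) (auto simp: max_def algebra_simps)
  finally show ?thesis .
qed

lemma W_space_iff:
  "F \<in> W_space \<longleftrightarrow> (\<forall>t. F t \<in> measure_unit_ball) \<and>
     (\<forall>f :: 'k::compact_hausdorff_space \<Rightarrow>\<^sub>C real. continuous_on UNIV (\<lambda>t. signed_integral (F t) f))"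
proof -
  let ?I = "\<lambda>\<mu> (f :: 'k \<Rightarrow>\<^sub>C real). signed_integral \<mu> (apply_bcontfun f)"
  have "continuous_map euclidean weak_star_topology F \<longleftrightarrow>
      (\<forall>f. continuous_on UNIV (\<lambda>t. ?I (F t) f))" if F: "\<And>t. F t \<in> regular_borel_measures"
  proof
    assume *: "continuous_map euclidean weak_star_topology F"
    have "continuous_map weak_star_topology (product_topology (\<lambda>_. euclideanreal) UNIV) (id \<circ> ?I)"
      unfolding weak_star_topology_def by (rule continuous_map_pullback) simp
    from continuous_map_compose[OF * this] show "\<forall>f. continuous_on UNIV (\<lambda>t. ?I (F t) f)"
      by (simp add: continuous_map_componentwise_UNIV)
  next
    assume *: "\<forall>f. continuous_on UNIV (\<lambda>t. ?I (F t) f)"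
    show "continuous_map euclidean weak_star_topology F"
      unfolding weak_star_topology_def
      using * F by (intro continuous_map_pullback') (auto simp: continuous_map_componentwise_UNIV o_def)
  qed
  then show ?thesis
    unfolding W_space_def by (auto simp: continuous_map_in_subtopology measure_unit_ball_def image_subset_iff)
qed

text \<open>The test functions 1 and the indicators of isolated points recover the two limits;
  conversely, the uniform norm bound lets these limits control all continuous functions.\<close>

lemma W_space_one_point_iff:
  fixes F :: "'g one_point \<Rightarrow> 'g one_point set \<Rightarrow> real"
  shows "F \<in> W_space \<longleftrightarrow>
    (\<exists>a. (\<forall>t. l1 (a t) \<and> tot (\<lambda>s. \<bar>a t s\<bar>) \<le> 1 \<and> F t = atomic_measure (a t)) \<and>
       ((\<lambda>t. tot (a t)) \<longlongrightarrow> tot (a pt_inf)) cofinite \<and>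
       (\<forall>s. s \<noteq> pt_inf \<longrightarrow> ((\<lambda>t. a t s) \<longlongrightarrow> a pt_inf s) cofinite))" (is "_ \<longleftrightarrow> (\<exists>a. ?R a)")
proof
  assume F: "F \<in> W_space"
  have "\<exists>b. l1 b \<and> F t = atomic_measure b" for t
  proof -
    have "F t \<in> regular_borel_measures"
      using F unfolding W_space_iff measure_unit_ball_def by blast
    then show ?thesis using regular_borel_measure_atomic by metis
  qed
  then obtain a where a: "\<And>t. l1 (a t)" "\<And>t. F t = atomic_measure (a t)" by metis
  have lim: "((\<lambda>t. tot (\<lambda>s. a t s * f s)) \<longlongrightarrow> tot (\<lambda>s. a pt_inf s * f s)) cofinite"
    if "(f \<longlongrightarrow> f pt_inf) cofinite" for f
  proof -
    let ?f = "Bcontfun f"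
    have f: "apply_bcontfun ?f = f" using that by (rule apply_Bcontfun_one_point)
    have "continuous_on UNIV (\<lambda>t. signed_integral (F t) ?f)"
      using F unfolding W_space_iff by blast
    moreover have "signed_integral (F t) ?f = tot (\<lambda>s. a t s * f s)" for t
      using signed_integral_atomic[OF a(1), of "apply_bcontfun ?f" "norm ?f" t] norm_bounded[of ?f]
      by (simp add: a(2) f)
    ultimately show ?thesis by (simp add: continuous_on_one_point_iff)
  qed
  have "((\<lambda>t. a t u) \<longlongrightarrow> a pt_inf u) cofinite" if "u \<noteq> pt_inf" for u
    using lim that by (rule coordinate_tendsto)
  moreover have "tot (\<lambda>s. \<bar>a t s\<bar>) \<le> 1" for t
  proof -
    have "F t \<in> measure_unit_ball" using F unfolding W_space_iff by blast
    then show ?thesis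
      using total_variation_atomic_UNIV[OF a(1), of t] by (simp add: measure_unit_ball_def a(2))
  qed
  ultimately have "?R a" using a lim[of "\<lambda>_. 1"] by auto
  then show "\<exists>a. ?R a" by blast
next
  assume "\<exists>a. ?R a"
  then obtain a where a: "\<And>t. l1 (a t)" "\<And>t. tot (\<lambda>s. \<bar>a t s\<bar>) \<le> 1" "\<And>t. F t = atomic_measure (a t)"
    "((\<lambda>t. tot (a t)) \<longlongrightarrow> tot (a pt_inf)) cofinite"
    "\<And>s. s \<noteq> pt_inf \<Longrightarrow> ((\<lambda>t. a t s) \<longlongrightarrow> a pt_inf s) cofinite" by blast
  show "F \<in> W_space"
    unfolding W_space_iff
  proof (intro conjI allI)
    show "F t \<in> measure_unit_ball" for t
      using a(1,2)[of t] by (simp add: a(3) measure_unit_ball_def regular_atomic_measure total_variation_atomic_UNIV)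
    fix f :: "'g one_point \<Rightarrow>\<^sub>C real"
    have "signed_integral (F t) f = tot (\<lambda>s. a t s * f s)" for t
      using signed_integral_atomic[OF a(1), of "apply_bcontfun f" "norm f" t] norm_bounded[of f]
      by (simp add: a(3))
    then show "continuous_on UNIV (\<lambda>t. signed_integral (F t) f)"
      using tot_mult_tendsto[OF a(1,2,1,4,5) bcontfun_tendsto_pt_inf[of f]]
      by (simp add: continuous_on_one_point_iff)
  qed
qed


section \<open>Local compensation\<close>

text \<open>If \<open>tot x \<le> 0\<close> then the factor is \<open>0\<close>, also when the denominator vanishes.\<close>

definition compensate :: "('a \<Rightarrow> real) \<Rightarrow> 'a \<Rightarrow> real" where
  "compensate x = (\<lambda>s. max 0 (tot x) / tot (\<lambda>s. max 0 (x s)) * max 0 (x s))"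

lemma compensate:
  assumes x: "l1 x"
  shows l1_compensate: "l1 (compensate x)"
    and compensate_nonneg: "0 \<le> compensate x s"
    and compensate_le: "compensate x s \<le> max 0 (x s)"
    and tot_compensate: "tot (compensate x) = max 0 (tot x)"
proof -
  define p where "p = tot (\<lambda>s. max 0 (x s))"
  have lp: "l1 (\<lambda>s. max 0 (x s))" using x by auto
  have p: "0 \<le> p" unfolding p_def by (rule Bochner_Integration.integral_nonneg) auto
  have le: "max 0 (tot x) \<le> p"
    using tot_mono[OF x lp] p unfolding p_def by simp
  have c: "compensate x = (\<lambda>s. max 0 (tot x) / p * max 0 (x s))"
    by (simp add: compensate_def p_def)
  show "l1 (compensate x)" unfolding c using lp by simp
  have "0 \<le> max 0 (tot x) / p" using p by simp
  moreover have "max 0 (tot x) / p \<le> 1" using p le by (cases "p = 0") (auto simp: divide_le_eq_1)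
  ultimately show "0 \<le> compensate x s" "compensate x s \<le> max 0 (x s)"
    unfolding c using mult_right_mono[of "max 0 (tot x) / p" 1 "max 0 (x s)"]
      mult_nonneg_nonneg[of "max 0 (tot x) / p" "max 0 (x s)"] by auto
  have "tot (compensate x) = max 0 (tot x) / p * p"
    unfolding c p_def by simp
  then show "tot (compensate x) = max 0 (tot x)" using le p by (cases "p = 0") auto
qed

lemma abs_compensate_le: "l1 x \<Longrightarrow> \<bar>compensate x s\<bar> \<le> \<bar>x s\<bar>"
  using compensate_nonneg[of x s] compensate_le[of x s] by auto

text \<open>The compensation of \<open>x\<close> that takes as much as possible from \<open>b\<close>, where \<open>0 \<le> b \<le> max 0 x\<close>, and
  distributes the rest proportionally.\<close>

definition base_weight :: "('a \<Rightarrow> real) \<Rightarrow> ('a \<Rightarrow> real) \<Rightarrow> real" where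
  "base_weight b x = min 1 (max 0 (tot x) / tot b)"

definition compensate_rest :: "('a \<Rightarrow> real) \<Rightarrow> ('a \<Rightarrow> real) \<Rightarrow> 'a \<Rightarrow> real" where
  "compensate_rest b x = compensate (\<lambda>s. x s - base_weight b x * b s)"

definition compensate_above :: "('a \<Rightarrow> real) \<Rightarrow> ('a \<Rightarrow> real) \<Rightarrow> 'a \<Rightarrow> real" where
  "compensate_above b x = (\<lambda>s. base_weight b x * b s + compensate_rest b x s)"

text \<open>The weight caps what is taken from \<open>b\<close> at the required total. It leaves
  room for the rest, as \<open>max 0 (x s - l * b s) = max 0 (x s) - l * b s\<close>: where
  \<open>x s < 0\<close>, also \<open>b s = 0\<close>.\<close>

lemma compensate_above:
  assumes x: "l1 x" and b: "l1 b" "\<And>s. 0 \<le> b s" "\<And>s. b s \<le> max 0 (x s)"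
  shows base_weight_nonneg: "0 \<le> base_weight b x"
    and base_weight_le_1: "base_weight b x \<le> 1"
    and base_weight_tot: "base_weight b x * tot b = min (tot b) (max 0 (tot x))"
    and l1_compensate_rest: "l1 (compensate_rest b x)"
    and compensate_rest_nonneg: "0 \<le> compensate_rest b x s"
    and compensate_rest_le: "compensate_rest b x s \<le> max 0 (x s) - base_weight b x * b s"
    and tot_compensate_rest: "tot (compensate_rest b x) = max 0 (tot x) - base_weight b x * tot b"
    and l1_compensate_above: "l1 (compensate_above b x)"
    and compensate_above_nonneg: "0 \<le> compensate_above b x s"
    and compensate_above_le: "compensate_above b x s \<le> max 0 (x s)"
    and tot_compensate_above: "tot (compensate_above b x) = max 0 (tot x)"
proof -
  define l where "l = base_weight b x"
  have tb: "0 \<le> tot b" using b by (intro Bochner_Integration.integral_nonneg) auto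
  have l: "0 \<le> l" "l \<le> 1" using tb by (auto simp: l_def base_weight_def)
  then show "0 \<le> base_weight b x" "base_weight b x \<le> 1" by (simp_all add: l_def)
  \<comment> \<open>For \<open>tot b = 0\<close> the quotient, and with it the weight, is 0 by
    convention; both sides are then 0.\<close>
  have lb: "l * tot b = min (tot b) (max 0 (tot x))"
  proof (cases "tot b = 0")
    case False
    then have "tot b > 0" using tb by simp
    then show ?thesis by (simp add: l_def base_weight_def min_mult_distrib_right)
  qed simp
  then show "base_weight b x * tot b = min (tot b) (max 0 (tot x))" by (simp add: l_def)
  have ly: "l1 (\<lambda>s. x s - l * b s)" using x b by auto
  note cy = compensate[OF ly, folded compensate_rest_def[of b x, folded l_def]]
  have tc: "tot (compensate_rest b x) = max 0 (tot x) - l * tot b"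
  proof -
    have "tot (\<lambda>s. x s - l * b s) = tot x - l * tot b" using x b by simp
    then show ?thesis using cy(4) lb tb by (auto simp: max_def min_def split: if_splits)
  qed
  then show "tot (compensate_rest b x) = max 0 (tot x) - base_weight b x * tot b" by (simp add: l_def)
  show "l1 (compensate_rest b x)" "0 \<le> compensate_rest b x s" using cy(1,2) by auto
  have nn: "0 \<le> l * b s" using l b by simp
  have "compensate_rest b x s \<le> max 0 (x s) - l * b s"
    using mult_right_mono[OF l(2) b(2)[of s]] b(3)[of s] nn cy(3)[of s] by linarith
  then show "compensate_rest b x s \<le> max 0 (x s) - base_weight b x * b s"
    and "compensate_above b x s \<le> max 0 (x s)"
    by (auto simp: l_def compensate_above_def)
  show "0 \<le> compensate_above b x s"
    using nn cy(2)[of s] by (simp add: l_def compensate_above_def)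
  show "l1 (compensate_above b x)" "tot (compensate_above b x) = max 0 (tot x)"
    using b(1) cy(1) tc by (auto simp: compensate_above_def l_def)
qed

text \<open>Sequences do not reach an arbitrary filter such as \<open>cofinite\<close> on an
  uncountable set. Instead, one finite set carries all but \<open>e / 3\<close> of the dominating
  family, uniformly in \<open>t\<close>, and finite sums converge.\<close>

lemma tot_tendsto_dominated:
  assumes c: "l1 c" and dom: "\<And>t s. \<bar>a t s\<bar> \<le> c s" "\<And>s. \<bar>b s\<bar> \<le> c s"
    and lim: "\<And>s. ((\<lambda>t. a t s) \<longlongrightarrow> b s) F"
  shows "((\<lambda>t. tot (a t)) \<longlongrightarrow> tot b) F"
proof (rule tendstoI)
  fix e :: real assume "e > 0"
  then obtain D where D: "finite D" "tot (\<lambda>s. indicator (-D) s * \<bar>c s\<bar>) < e / 3"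
    using l1_tail[OF c, of "e / 3"] by auto
  have l: "l1 (a t)" "l1 b" for t using l1_bound[OF c] dom by auto
  have "((\<lambda>t. sum (a t) D) \<longlongrightarrow> sum b D) F" by (intro tendsto_sum lim)
  then have "\<forall>\<^sub>F t in F. dist (sum (a t) D) (sum b D) < e / 3"
    by (rule tendstoD) (use \<open>e > 0\<close> in simp)
  then show "\<forall>\<^sub>F t in F. dist (tot (a t)) (tot b) < e"
  proof (rule eventually_mono)
    fix t assume *: "dist (sum (a t) D) (sum b D) < e / 3"
    have tail: "\<bar>tot (\<lambda>s. indicator (-D) s * x s)\<bar> < e / 3" if "l1 x" "\<And>s. \<bar>x s\<bar> \<le> c s" for x
    proof -
      have "\<bar>tot (\<lambda>s. indicator (-D) s * x s)\<bar> \<le> tot (\<lambda>s. \<bar>indicator (-D) s * x s\<bar>)"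
        by (rule integral_abs_bound)
      also have "\<dots> \<le> tot (\<lambda>s. indicator (-D) s * \<bar>c s\<bar>)"
        using that c by (intro tot_mono) (auto intro: order_trans[OF that(2)] split: split_indicator)
      finally show ?thesis using D by simp
    qed
    show "dist (tot (a t)) (tot b) < e"
      using tot_split_finite[OF l(1) D(1), of t] tot_split_finite[OF l(2) D(1)]
        tail[OF l(1) dom(1), of t] tail[OF l(2) dom(2)] * unfolding dist_real_def by linarith
  qed
qed

text \<open>The value at the point at infinity takes its mass from the isolated points as far as possible.
  Then either it exhausts the positive part at all isolated points, or it has no mass at infinity.
  Nearby values start from what they have in common with it; in both cases the rest, distributed
  proportionally, vanishes in the limit at every isolated point.\<close>

lemma local_compensation_atomic:
  fixes a :: "'g one_point \<Rightarrow> 'g one_point \<Rightarrow> real"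
  assumes l: "\<And>t. l1 (a t)"
    and lim_tot: "((\<lambda>t. tot (a t)) \<longlongrightarrow> tot (a pt_inf)) cofinite"
    and lim_coord: "\<And>s. s \<noteq> pt_inf \<Longrightarrow> ((\<lambda>t. a t s) \<longlongrightarrow> a pt_inf s) cofinite"
  obtains g where "\<And>t. l1 (g t)" "\<And>t s. 0 \<le> g t s" "\<And>t s. g t s \<le> max 0 (a t s)"
    "\<And>t. tot (g t) = max 0 (tot (a t))"
    "((\<lambda>t. tot (g t)) \<longlongrightarrow> tot (g pt_inf)) cofinite"
    "\<And>s. s \<noteq> pt_inf \<Longrightarrow> ((\<lambda>t. g t s) \<longlongrightarrow> g pt_inf s) cofinite"
proof -
  define G :: "'g one_point set" where "G = - {pt_inf}"
  define x where "x = a pt_inf"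
  define b0 where "b0 = (\<lambda>s. indicator G s * max 0 (x s))"
  have lx: "l1 x" by (simp add: x_def l)
  have lb0: "l1 b0" unfolding b0_def using lx by auto
  have b0: "0 \<le> b0 s" "b0 s \<le> max 0 (x s)" for s
    by (auto simp: b0_def split: split_indicator)
  define g0 where "g0 = compensate_above b0 x"
  define l0 where "l0 = base_weight b0 x"
  note g0 = compensate_above[OF lx lb0 b0, folded g0_def l0_def]
  have g0_nn: "0 \<le> g0 s" for s by (rule g0(9))
  have g0_ge: "l0 * b0 s \<le> g0 s" for s
    using g0(5)[of s] by (simp add: g0_def compensate_above_def l0_def)
  define h where "h = (\<lambda>s. indicator G s * g0 s)"
  have lh: "l1 h" unfolding h_def using g0(8) by auto
  have h_le: "tot h \<le> max 0 (tot x)"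
    unfolding g0(11)[symmetric] using lh g0(8) g0_nn by (intro tot_mono) (auto simp: h_def split: split_indicator)
  have dichotomy: "(\<forall>s\<in>G. g0 s = max 0 (x s)) \<or> tot h = max 0 (tot x)"
  proof (cases "tot b0 \<le> max 0 (tot x)")
    case True
    \<comment> \<open>The weight is 0 when \<open>tot b0 = 0\<close>, but then the nonnegative
      family \<open>b0\<close> vanishes at every point.\<close>
    then consider "l0 = 1" | "tot b0 = 0" using g0(3) by (auto simp: min_def)
    then have "b0 s \<le> g0 s" for s
    proof cases
      case 1
      then show ?thesis using g0_ge[of s] by simp
    next
      case 2
      have "\<bar>b0 s\<bar> \<le> tot (\<lambda>s. \<bar>b0 s\<bar>)" by (rule abs_le_tot[OF lb0])
      also have "\<dots> = 0" using 2 b0(1) by simp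
      finally show ?thesis using g0_nn[of s] by simp
    qed
    then have "g0 s = max 0 (x s)" if "s \<in> G" for s
      using that g0(10)[of s] by (intro antisym) (auto simp: b0_def dest!: meta_spec[of _ s])
    then show ?thesis by blast
  next
    case False
    then have "max 0 (tot x) = tot (\<lambda>s. l0 * b0 s)" using g0(3) by simp
    also have "\<dots> \<le> tot h"
    proof (intro tot_mono)
      show "l0 * b0 s \<le> h s" for s
        using g0_ge[of s] by (cases "s \<in> G") (auto simp: h_def b0_def)
    qed (use lb0 lh in auto)
    finally show ?thesis using h_le by (intro disjI2 antisym)
  qed
  \<comment> \<open>Cutting off at \<open>g0\<close> makes the common part dominated by one summable
    family; so its total converges, whereas the total of the positive part of \<open>a t\<close>
    need not.\<close>
  define b where "b = (\<lambda>t s. indicator G s * min (max 0 (a t s)) (g0 s))"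
  have b: "0 \<le> b t s" "b t s \<le> max 0 (a t s)" "\<bar>b t s\<bar> \<le> g0 s" for t s
    using g0_nn[of s] by (auto simp: b_def split: split_indicator)
  have lb: "l1 (b t)" for t using b(3) g0(8) by (rule l1_bound[rotated])
  define M where "M = (\<lambda>t. max 0 (tot (a t)))"
  define L where "L = (\<lambda>t. base_weight (b t) (a t))"
  define r where "r = (\<lambda>t. compensate_rest (b t) (a t))"
  note gb = compensate_above[OF l lb b(1,2)]
  have L: "L t \<le> 1" "L t * tot (b t) = min (tot (b t)) (M t)" for t
    using gb(2,3)[of t] by (simp_all add: L_def M_def)
  have r: "l1 (r t)" "0 \<le> r t s" "r t s \<le> max 0 (a t s) - L t * b t s"
      "tot (r t) = M t - L t * tot (b t)" for t s
    using gb(4,7)[of t] gb(5,6)[of t s] by (simp_all add: L_def M_def r_def)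
  have lim_M: "(M \<longlongrightarrow> max 0 (tot x)) cofinite"
    unfolding M_def x_def by (intro tendsto_intros lim_tot)
  have lim_pos: "((\<lambda>t. max 0 (a t s)) \<longlongrightarrow> max 0 (x s)) cofinite" if "s \<in> G" for s
    using that unfolding x_def G_def by (intro tendsto_intros lim_coord) simp
  have lim_b: "((\<lambda>t. b t s) \<longlongrightarrow> h s) cofinite" for s
  proof (cases "s \<in> G")
    case True
    have "((\<lambda>t. min (max 0 (a t s)) (g0 s)) \<longlongrightarrow> min (max 0 (x s)) (g0 s)) cofinite"
      by (intro tendsto_min lim_pos True tendsto_const)
    then show ?thesis using True g0(10)[of s] by (simp add: b_def h_def)
  qed (simp add: b_def h_def)
  have lim_tb: "((\<lambda>t. tot (b t)) \<longlongrightarrow> tot h) cofinite"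
    by (rule tot_tendsto_dominated[OF g0(8) b(3) _ lim_b])
      (use g0_nn in \<open>auto simp: h_def split: split_indicator\<close>)
  have lim_Lb: "((\<lambda>t. L t * tot (b t)) \<longlongrightarrow> tot h) cofinite"
    using tendsto_min[OF lim_tb lim_M] h_le by (simp add: L(2))
  \<comment> \<open>The loss \<open>b t s - L t * b t s\<close> is nonnegative, so at each point it
    is at most its total over \<open>s\<close>, which tends to 0.\<close>
  have lim_Lbs: "((\<lambda>t. L t * b t s) \<longlongrightarrow> h s) cofinite" for s
  proof -
    have "((\<lambda>t. b t s - L t * b t s) \<longlongrightarrow> 0) cofinite"
    proof (rule Lim_null_comparison)
      have "norm (b t s - L t * b t s) \<le> tot (b t) - L t * tot (b t)" for t
      proof -
        have nn: "0 \<le> b t u - L t * b t u" for u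
          using mult_right_mono[OF L(1) b(1), of t t u] by simp
        have "\<bar>b t s - L t * b t s\<bar> \<le> tot (\<lambda>s. \<bar>b t s - L t * b t s\<bar>)"
          using lb by (intro abs_le_tot) auto
        then show ?thesis using lb by (simp add: abs_of_nonneg[OF nn])
      qed
      then show "\<forall>\<^sub>F t in cofinite. norm (b t s - L t * b t s) \<le> tot (b t) - L t * tot (b t)"
        by simp
      show "((\<lambda>t. tot (b t) - L t * tot (b t)) \<longlongrightarrow> 0) cofinite"
        using tendsto_diff[OF lim_tb lim_Lb] by simp
    qed
    from tendsto_diff[OF lim_b[of s] this] show ?thesis by simp
  qed
  \<comment> \<open>In the first case of the dichotomy the rest is squeezed by the positive part
    still available at \<open>s\<close>, which tends to 0; in the second its whole mass tends to
    0.\<close>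
  have lim_r: "((\<lambda>t. r t s) \<longlongrightarrow> 0) cofinite" if s: "s \<in> G" for s
    using dichotomy
  proof
    assume "\<forall>s\<in>G. g0 s = max 0 (x s)"
    then have "h s = max 0 (x s)" using s by (simp add: h_def)
    then have "((\<lambda>t. max 0 (a t s) - L t * b t s) \<longlongrightarrow> 0) cofinite"
      using tendsto_diff[OF lim_pos[OF s] lim_Lbs[of s]] by simp
    then show ?thesis
      by (rule Lim_null_comparison[rotated]) (simp add: r(2,3))
  next
    assume "tot h = max 0 (tot x)"
    then have lim0: "((\<lambda>t. M t - L t * tot (b t)) \<longlongrightarrow> 0) cofinite"
      using tendsto_diff[OF lim_M lim_Lb] by simp
    have bd: "norm (r t s) \<le> M t - L t * tot (b t)" for t
      using abs_le_tot[OF r(1), of t s] r(2)[of t] by (simp add: r(4))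
    show ?thesis
      by (rule Lim_null_comparison[OF always_eventually[OF allI[OF bd]] lim0])
  qed
  define g where "g = (\<lambda>t. if t = pt_inf then g0 else compensate_above (b t) (a t))"
  have gt: "l1 (g t) \<and> (\<forall>s. 0 \<le> g t s \<and> g t s \<le> max 0 (a t s)) \<and> tot (g t) = M t" for t
  proof (cases "t = pt_inf")
    case True
    then show ?thesis using g0(8,10,11) g0_nn by (simp add: g_def M_def x_def)
  next
    case False
    then show ?thesis using gb(8-11)[of t] by (simp add: g_def M_def)
  qed
  have ev: "\<forall>\<^sub>F t in cofinite. t \<noteq> pt_inf" by (simp add: eventually_cofinite)
  show ?thesis
  proof (rule that[of g])
    show "((\<lambda>t. tot (g t)) \<longlongrightarrow> tot (g pt_inf)) cofinite"
      using lim_M gt by (simp add: M_def x_def)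
    show "((\<lambda>t. g t s) \<longlongrightarrow> g pt_inf s) cofinite" if s: "s \<noteq> pt_inf" for s
    proof -
      have "((\<lambda>t. L t * b t s + r t s) \<longlongrightarrow> g0 s) cofinite"
        using tendsto_add[OF lim_Lbs[of s] lim_r[of s]] s by (simp add: h_def G_def)
      moreover have "\<forall>\<^sub>F t in cofinite. L t * b t s + r t s = g t s"
        using ev by eventually_elim (simp add: g_def L_def r_def compensate_above_def)
      ultimately show ?thesis using tendsto_cong by (fastforce simp: g_def)
    qed
  qed (use gt in \<open>auto simp: M_def\<close>)
qed

lemma admits_local_compensation_one_point: "admits_local_compensation TYPE('g one_point)"
  unfolding admits_local_compensation_def
proof
  fix F :: "'g one_point \<Rightarrow> 'g one_point set \<Rightarrow> real" assume "F \<in> W_space"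
  then obtain a where a: "\<And>t. l1 (a t)" "\<And>t. tot (\<lambda>s. \<bar>a t s\<bar>) \<le> 1" "\<And>t. F t = atomic_measure (a t)"
    "((\<lambda>t. tot (a t)) \<longlongrightarrow> tot (a pt_inf)) cofinite"
    "\<And>s. s \<noteq> pt_inf \<Longrightarrow> ((\<lambda>t. a t s) \<longlongrightarrow> a pt_inf s) cofinite"
    unfolding W_space_one_point_iff by blast
  obtain g where g: "\<And>t. l1 (g t)" "\<And>t s. 0 \<le> g t s" "\<And>t s. g t s \<le> max 0 (a t s)"
    "\<And>t. tot (g t) = max 0 (tot (a t))"
    "((\<lambda>t. tot (g t)) \<longlongrightarrow> tot (g pt_inf)) cofinite"
    "\<And>s. s \<noteq> pt_inf \<Longrightarrow> ((\<lambda>t. g t s) \<longlongrightarrow> g pt_inf s) cofinite"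
    using local_compensation_atomic[OF a(1,4,5)] by blast
  show "\<exists>G\<in>W_space. \<forall>t. measure_compensation (G t) (F t)"
  proof (rule bexI[of _ "\<lambda>t. atomic_measure (g t)"])
    have "tot (\<lambda>s. \<bar>g t s\<bar>) \<le> 1" for t
    proof -
      have "\<bar>g t s\<bar> \<le> \<bar>a t s\<bar>" for s using g(2,3)[of t s] by auto
      then have "tot (\<lambda>s. \<bar>g t s\<bar>) \<le> tot (\<lambda>s. \<bar>a t s\<bar>)"
        using g(1) a(1) by (intro tot_mono) auto
      then show ?thesis using a(2)[of t] by simp
    qed
    then show "(\<lambda>t. atomic_measure (g t)) \<in> W_space"
      unfolding W_space_one_point_iff using g(1,5,6) by (intro exI[of _ g]) auto
    show "\<forall>t. measure_compensation (atomic_measure (g t)) (F t)"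
    proof
      fix t
      have zero: "atomic_measure (g t) = (\<lambda>_. 0)" if "tot (a t) \<le> 0"
      proof -
        have "g t s = 0" for s
          using abs_le_tot[OF g(1), of t s] g(2)[of t] g(4)[of t] that by (auto intro: antisym)
        then show ?thesis by (simp add: atomic_measure_def fun_eq_iff)
      qed
      have pos: "0 \<le> atomic_measure (g t) A \<and> atomic_measure (g t) A \<le> pos_part (F t) A" for A
        unfolding a(3) pos_part_atomic[OF a(1)]
        using g(1,2,3) a(1)
        by (auto simp: atomic_measure_def intro!: tot_mono Bochner_Integration.integral_nonneg
            split: split_indicator)
      show "measure_compensation (atomic_measure (g t)) (F t)"
        unfolding measure_compensation_def
        using regular_atomic_measure[OF g(1)] pos zero g(4)[of t] by (auto simp: a(3))
    qed
  qed
qed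

section \<open>Functionals and operators on the continuous functions\<close>

lemma bounded_linear_tot_mult:
  fixes k :: "'g one_point \<Rightarrow> real"
  assumes k: "l1 k"
  shows "bounded_linear (\<lambda>f :: 'g one_point \<Rightarrow>\<^sub>C real. tot (\<lambda>s. k s * f s))"
proof (rule bounded_linear_intro)
  note l = l1_mult_bounded[OF k, of "apply_bcontfun f" "norm f" for f]
  have l: "l1 (\<lambda>s. k s * f s)" for f :: "'g one_point \<Rightarrow>\<^sub>C real"
    using l[of f] norm_bounded[of f] by simp
  show "tot (\<lambda>s. k s * (f + g) s) = tot (\<lambda>s. k s * f s) + tot (\<lambda>s. k s * g s)"
    for f g :: "'g one_point \<Rightarrow>\<^sub>C real"
    using l by (simp add: plus_bcontfun.rep_eq ring_distribs)
  show "tot (\<lambda>s. k s * (r *\<^sub>R f) s) = r *\<^sub>R tot (\<lambda>s. k s * f s)"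
    for r and f :: "'g one_point \<Rightarrow>\<^sub>C real"
    by (simp add: mult.left_commute)
  show "norm (tot (\<lambda>s. k s * f s)) \<le> norm f * tot (\<lambda>s. \<bar>k s\<bar>)" for f :: "'g one_point \<Rightarrow>\<^sub>C real"
    using tot_mult_bound[OF k, of "apply_bcontfun f" "norm f"] norm_bounded[of f]
    by (simp add: mult.commute)
qed

text \<open>Off a finite set the function takes its value at \<open>pt_inf\<close>, which makes it
  continuous; the tail of \<open>k\<close> is then lost at most twice. Modulus exactly 1 everywhere
  lets \<open>f\<close> form a state pair with a multiple of the evaluation at any point.\<close>

lemma almost_norming_function:
  fixes k :: "'g one_point \<Rightarrow> real"
  assumes k: "l1 k" and "e > 0"
  obtains f :: "'g one_point \<Rightarrow>\<^sub>C real"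
  where "\<And>s. \<bar>f s\<bar> = 1" "tot (\<lambda>s. k s * f s) \<ge> tot (\<lambda>s. \<bar>k s\<bar>) - e"
proof -
  obtain D where D: "finite D" "tot (\<lambda>s. indicator (-D) s * \<bar>k s\<bar>) < e / 2"
    using l1_tail[OF k, of "e / 2"] \<open>e > 0\<close> by auto
  \<comment> \<open>Unlike \<open>sgn\<close>, this has value 1 at 0, so the modulus is 1
    throughout.\<close>
  define sg where "sg = (\<lambda>x::real. if x \<ge> 0 then 1 else - 1 :: real)"
  have sg: "\<bar>sg x\<bar> = 1" "x * sg x = \<bar>x\<bar>" for x by (auto simp: sg_def)
  define F where "F = (\<lambda>s. if s \<in> D then sg (k s) else sg (k pt_inf))"
  have F: "\<bar>F s\<bar> = 1" for s by (simp add: F_def sg)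
  have Fp: "F pt_inf = sg (k pt_inf)" by (simp add: F_def)
  have "(F \<longlongrightarrow> F pt_inf) cofinite"
    unfolding Fp using D(1)
    by (intro tendsto_eventually) (auto simp: eventually_cofinite F_def elim: finite_subset[rotated])
  then have app: "apply_bcontfun (Bcontfun F) = F" by (rule apply_Bcontfun_one_point)
  have lkF: "l1 (\<lambda>s. k s * F s)" using l1_mult_bounded[OF k, of F 1] F by simp
  have "tot (\<lambda>s. \<bar>k s\<bar>) - 2 * tot (\<lambda>s. indicator (-D) s * \<bar>k s\<bar>)
      = tot (\<lambda>s. \<bar>k s\<bar> - 2 * (indicator (-D) s * \<bar>k s\<bar>))"
    using k by simp
  also have "\<dots> \<le> tot (\<lambda>s. k s * F s)"
  proof (intro tot_mono lkF)
    show "\<bar>k s\<bar> - 2 * (indicator (-D) s * \<bar>k s\<bar>) \<le> k s * F s" for s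
    proof (cases "s \<in> D")
      case True
      then show ?thesis by (simp add: F_def sg)
    next
      case False
      have "\<bar>k s * F s\<bar> = \<bar>k s\<bar>" by (simp add: abs_mult F)
      then have "- \<bar>k s\<bar> \<le> k s * F s" by linarith
      then show ?thesis using False by simp
    qed
  qed (use k in auto)
  finally show ?thesis using D(2) F by (intro that[of "Bcontfun F"]) (auto simp: app)
qed

text \<open>The Riesz representation for this space. Spikes give the coefficients at isolated
  points, and the value at the constant 1 fixes the coefficient at \<open>pt_inf\<close>. Two
  bounded functionals that agree on constants and spikes agree, since these span a uniformly dense
  subspace.\<close>

lemma functional_representation:
  fixes \<phi> :: "('g one_point \<Rightarrow>\<^sub>C real) \<Rightarrow> real"
  assumes \<phi>: "bounded_linear \<phi>" and B: "\<And>f. \<bar>\<phi> f\<bar> \<le> B * norm f"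
  obtains k where "l1 k" "tot (\<lambda>s. \<bar>k s\<bar>) \<le> B" "\<And>f. \<phi> f = tot (\<lambda>s. k s * f s)"
proof -
  define G :: "'g one_point set" where "G = - {pt_inf}"
  define one :: "'g one_point \<Rightarrow>\<^sub>C real" where "one = const_bcontfun 1"
  define spike :: "'g one_point \<Rightarrow> ('g one_point \<Rightarrow>\<^sub>C real)"
    where "spike = (\<lambda>u. Bcontfun (\<lambda>s. if s = u then 1 else 0))"
  have one: "one s = 1" for s by (simp add: one_def const_bcontfun.rep_eq)
  have spike: "spike u s = (if s = u then 1 else 0)" if "u \<in> G" for u s
  proof -
    have "((\<lambda>s. if s = u then 1 else 0 :: real) \<longlongrightarrow> (if pt_inf = u then 1 else 0)) cofinite"
      by (rule tendsto_eventually) (use that in \<open>auto simp: eventually_cofinite G_def\<close>)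
    then show ?thesis unfolding spike_def by (subst apply_Bcontfun_one_point) auto
  qed
  have combination: "(\<Sum>u\<in>D. c u *\<^sub>R spike u) s = (if s \<in> D then c s else 0)"
    if "finite D" "D \<subseteq> G" for D c s
    using that by (induction D rule: finite_induct) (auto simp: spike plus_bcontfun.rep_eq)
  have \<phi>l: "linear \<phi>" using \<phi> by (rule bounded_linear.linear)
  define k0 where "k0 = (\<lambda>s. indicator G s * \<phi> (spike s))"
  have lk0: "l1 k0"
    unfolding k0_def
  proof (rule l1_finite_sums)
    fix D assume D: "finite D" "D \<subseteq> G"
    \<comment> \<open>Spikes at different points have disjoint supports, so this combination with
      signs has norm at most 1, while \<open>\<phi>\<close> maps it to the sum of absolute
      values.\<close>
    let ?g = "\<Sum>u\<in>D. sgn (\<phi> (spike u)) *\<^sub>R spike u"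
    have "\<bar>?g s\<bar> \<le> 1" for s
      unfolding combination[OF D] by (auto simp: sgn_if)
    then have "norm ?g \<le> 1" by (simp add: norm_bcontfun_le_iff)
    moreover have "B \<ge> 0"
    proof -
      have "norm one \<ge> 1" using norm_bounded[of one pt_inf] by (simp add: one)
      moreover have "0 \<le> B * norm one" using B[of one] by linarith
      ultimately show ?thesis by (auto simp: zero_le_mult_iff)
    qed
    ultimately have "B * norm ?g \<le> B" by (simp add: mult_left_le)
    moreover have "\<phi> ?g = (\<Sum>u\<in>D. \<bar>\<phi> (spike u)\<bar>)"
      by (simp add: linear_sum[OF \<phi>l] linear_scale[OF \<phi>l] abs_sgn mult.commute)
    ultimately show "(\<Sum>u\<in>D. \<bar>\<phi> (spike u)\<bar>) \<le> B" using B[of ?g] by linarith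
  qed
  define k where "k = (\<lambda>s. k0 s + (if s = pt_inf then \<phi> one - tot k0 else 0))"
  have lk: "l1 k" unfolding k_def by (intro Bochner_Integration.integrable_add lk0 l1_single)
  have tk: "tot k = \<phi> one"
    unfolding k_def by (subst Bochner_Integration.integral_add[OF lk0 l1_single]) (simp add: tot_single)
  define D where "D = (\<lambda>f :: 'g one_point \<Rightarrow>\<^sub>C real. \<phi> f - tot (\<lambda>s. k s * f s))"
  have bD: "bounded_linear D"
    unfolding D_def by (intro bounded_linear_sub \<phi> bounded_linear_tot_mult lk)
  then have lD: "linear D" by (rule bounded_linear.linear)
  obtain C where C: "C > 0" "\<And>f. \<bar>D f\<bar> \<le> norm f * C"
    using bounded_linear.pos_bounded[OF bD] by auto
  have D_one: "D one = 0" by (simp add: D_def one tk)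
  have D_spike: "D (spike u) = 0" if u: "u \<in> G" for u
  proof -
    have "tot (\<lambda>s. k s * spike u s) = tot (\<lambda>s. if s = u then k u else 0)"
      using u by (intro Bochner_Integration.integral_cong) (auto simp: spike)
    then show ?thesis using u by (auto simp: D_def tot_single k_def k0_def G_def)
  qed
  have "D f = 0" for f
  proof (rule ccontr)
    assume "D f \<noteq> 0"
    \<comment> \<open>Chosen so that approximating \<open>f\<close> up to \<open>d\<close> bounds
      \<open>|D f|\<close> by half of itself.\<close>
    define d where "d = \<bar>D f\<bar> / (2 * C)"
    have d: "d > 0" using C(1) \<open>D f \<noteq> 0\<close> by (simp add: d_def)
    define H where "H = {s. \<not> dist (f s) (f pt_inf) < d}"
    have H: "finite H" "H \<subseteq> G"
      using tendstoD[OF bcontfun_tendsto_pt_inf[of f] d] d by (auto simp: eventually_cofinite H_def G_def)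
    define g where "g = f pt_inf *\<^sub>R one + (\<Sum>u\<in>H. (f u - f pt_inf) *\<^sub>R spike u)"
    have "D g = 0"
      unfolding g_def using H(2)
      by (auto simp: linear_add[OF lD] linear_sum[OF lD] linear_scale[OF lD] D_one D_spike intro!: sum.neutral)
    then have "D f = D (f - g)" by (simp add: linear_diff[OF lD])
    moreover have "norm (f - g) \<le> d"
    proof -
      have "(f - g) s = (if s \<in> H then 0 else f s - f pt_inf)" for s
        by (simp add: g_def minus_bcontfun.rep_eq plus_bcontfun.rep_eq combination[OF H] one)
      then have "\<bar>(f - g) s\<bar> \<le> d" for s
        using d by (auto simp: H_def dist_real_def)
      then show ?thesis by (simp add: norm_bcontfun_le_iff)
    qed
    ultimately have "\<bar>D f\<bar> \<le> d * C"
      using C(2)[of "f - g"] C(1) by (smt (verit) mult_right_mono)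
    also have "\<dots> = \<bar>D f\<bar> / 2" using C(1) by (simp add: d_def)
    finally show False using \<open>D f \<noteq> 0\<close> by simp
  qed
  then have rep: "\<phi> f = tot (\<lambda>s. k s * f s)" for f by (simp add: D_def)
  have "tot (\<lambda>s. \<bar>k s\<bar>) \<le> B"
  proof (rule field_le_epsilon)
    fix e :: real assume "e > 0"
    then obtain f :: "'g one_point \<Rightarrow>\<^sub>C real"
      where f: "\<And>s. \<bar>f s\<bar> = 1" "tot (\<lambda>s. k s * f s) \<ge> tot (\<lambda>s. \<bar>k s\<bar>) - e"
      using almost_norming_function[OF lk] by blast
    have "norm f = 1"
      using norm_bounded[of f pt_inf] f(1) by (intro antisym) (auto simp: norm_bcontfun_le_iff)
    then show "tot (\<lambda>s. \<bar>k s\<bar>) \<le> B + e" using B[of f] f(2) rep[of f] by auto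
  qed
  then show ?thesis using that lk rep by blast
qed

section \<open>Dual functionals, state pairs and the numerical radius\<close>

lemma abs_apply_blinfun_real_le:
  fixes x' :: "'x::real_normed_vector \<Rightarrow>\<^sub>L real"
  shows "\<bar>blinfun_apply x' x\<bar> \<le> norm x' * norm x"
  using norm_blinfun[of x' x] by simp

lemma dual_representation:
  fixes x' :: "('g one_point \<Rightarrow>\<^sub>C real) \<Rightarrow>\<^sub>L real"
  obtains k where "l1 k" "tot (\<lambda>s. \<bar>k s\<bar>) \<le> norm x'" "\<And>f. blinfun_apply x' f = tot (\<lambda>s. k s * f s)"
  by (rule functional_representation[OF blinfun.bounded_linear_right[of x'] abs_apply_blinfun_real_le[of x']])
    (rule that)

lemma norm_le_of_representation:
  fixes x' :: "('g one_point \<Rightarrow>\<^sub>C real) \<Rightarrow>\<^sub>L real"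
  assumes "l1 k" "\<And>f. blinfun_apply x' f = tot (\<lambda>s. k s * f s)"
  shows "norm x' \<le> tot (\<lambda>s. \<bar>k s\<bar>)"
proof (rule norm_blinfun_bound)
  show "0 \<le> tot (\<lambda>s. \<bar>k s\<bar>)" by (rule Bochner_Integration.integral_nonneg) simp
  show "norm (blinfun_apply x' f) \<le> tot (\<lambda>s. \<bar>k s\<bar>) * norm f" for f
    using tot_mult_bound[OF assms(1), of "apply_bcontfun f" "norm f"] norm_bounded[of f]
    by (simp add: assms(2))
qed

lemma state_pairI:
  assumes "norm x \<le> 1" "norm x' \<le> 1" "blinfun_apply x' x = 1"
  shows "(x, x') \<in> state_pairs"
proof -
  have 1: "1 \<le> norm x' * norm x"
    using abs_apply_blinfun_real_le[of x' x] assms(3) by simp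
  have "norm x' * norm x \<le> 1 * norm x" using assms(2) by (rule mult_right_mono) simp
  moreover have "norm x' * norm x \<le> norm x' * 1" using assms(1) by (rule mult_left_mono) simp
  ultimately show ?thesis using 1 assms by (auto simp: state_pairs_def)
qed

lemma abs_state_pair_le_norm:
  assumes "(x, x') \<in> state_pairs"
  shows "\<bar>blinfun_apply x' (blinfun_apply T x)\<bar> \<le> norm T"
  using abs_apply_blinfun_real_le[of x' "blinfun_apply T x"] norm_blinfun[of T x] assms
  by (auto simp: state_pairs_def)

lemma abs_state_pair_le_numerical_radius:
  assumes "(x, x') \<in> state_pairs"
  shows "\<bar>blinfun_apply x' (blinfun_apply T x)\<bar> \<le> numerical_radius T"
proof -
  have "bdd_above ((\<lambda>(x, x'). \<bar>blinfun_apply x' (blinfun_apply T x)\<bar>) ` state_pairs)"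
    by (rule bdd_aboveI2[of _ _ "norm T"]) (auto simp: abs_state_pair_le_norm)
  from cSUP_upper[OF assms this] show ?thesis by (simp add: numerical_radius_def)
qed

text \<open>The given pair ensures that the supremum is over a non-empty set.\<close>

lemma numerical_radius_le_norm:
  fixes T :: "'x::real_normed_vector \<Rightarrow>\<^sub>L 'x"
  assumes "(x :: 'x, x') \<in> state_pairs"
  shows "numerical_radius T \<le> norm T"
  unfolding numerical_radius_def
  using assms by (intro cSUP_least) (auto simp: abs_state_pair_le_norm)

text \<open>Evaluation at \<open>t\<close> multiplied by the sign \<open>f t\<close> forms a state
  pair with any \<open>f\<close> of modulus 1, and almost norming functions of this kind detect the
  norm of the row. Hence the numerical radius is the operator norm on this space, and operators can
  be compared in norm.\<close>

lemma tot_row_le_numerical_radius: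
  fixes T :: "('g one_point \<Rightarrow>\<^sub>C real) \<Rightarrow>\<^sub>L ('g one_point \<Rightarrow>\<^sub>C real)"
  assumes k: "l1 k" and T: "\<And>f. blinfun_apply T f t = tot (\<lambda>s. k s * f s)"
  shows "tot (\<lambda>s. \<bar>k s\<bar>) \<le> numerical_radius T"
proof (rule field_le_epsilon)
  fix e :: real assume "e > 0"
  then obtain f :: "'g one_point \<Rightarrow>\<^sub>C real"
    where f: "\<And>s. \<bar>f s\<bar> = 1" "tot (\<lambda>s. k s * f s) \<ge> tot (\<lambda>s. \<bar>k s\<bar>) - e"
    using almost_norming_function[OF k] by blast
  have bl: "bounded_linear (\<lambda>g :: 'g one_point \<Rightarrow>\<^sub>C real. f t * g t)"
  proof (rule bounded_linear_intro[of _ 1])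
    show "norm (f t * g t) \<le> norm g * 1" for g :: "'g one_point \<Rightarrow>\<^sub>C real"
      using norm_bounded[of g t] f(1)[of t] by (simp add: abs_mult)
  qed (auto simp: plus_bcontfun.rep_eq ring_distribs mult.left_commute)
  define x' where "x' = Blinfun (\<lambda>g :: 'g one_point \<Rightarrow>\<^sub>C real. f t * g t)"
  have x': "blinfun_apply x' g = f t * g t" for g
    using bl by (simp add: x'_def bounded_linear_Blinfun_apply)
  have "norm f \<le> 1" by (simp add: norm_bcontfun_le_iff f(1))
  moreover have "norm x' \<le> 1"
  proof (rule norm_blinfun_bound)
    show "norm (blinfun_apply x' g) \<le> 1 * norm g" for g
      using norm_bounded[of g t] f(1)[of t] by (simp add: x' abs_mult)
  qed simp
  moreover have "blinfun_apply x' f = 1"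
    using f(1)[of t] by (simp add: x' power2_eq_square[symmetric] power2_eq_1_iff abs_if split: if_splits)
  ultimately have "(f, x') \<in> state_pairs" by (rule state_pairI)
  from abs_state_pair_le_numerical_radius[OF this, of T]
  have "\<bar>blinfun_apply T f t\<bar> \<le> numerical_radius T" by (simp add: x' abs_mult f(1))
  then show "tot (\<lambda>s. \<bar>k s\<bar>) \<le> numerical_radius T + e" using f(2) T[of f] by linarith
qed

section \<open>Operators as families of rows\<close>

lemma operator_rows:
  fixes T :: "('g one_point \<Rightarrow>\<^sub>C real) \<Rightarrow>\<^sub>L ('g one_point \<Rightarrow>\<^sub>C real)"
  obtains a where "\<And>t. l1 (a t)" "\<And>t. tot (\<lambda>s. \<bar>a t s\<bar>) \<le> numerical_radius T"
    "\<And>f t. blinfun_apply T f t = tot (\<lambda>s. a t s * f s)"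
    "((\<lambda>t. tot (a t)) \<longlongrightarrow> tot (a pt_inf)) cofinite"
    "\<And>s. s \<noteq> pt_inf \<Longrightarrow> ((\<lambda>t. a t s) \<longlongrightarrow> a pt_inf s) cofinite"
proof -
  have "\<exists>k. l1 k \<and> (\<forall>f. blinfun_apply T f t = tot (\<lambda>s. k s * f s))" for t
  proof -
    have "bounded_linear (\<lambda>f. blinfun_apply T f t)"
    proof (rule bounded_linear_intro[of _ "norm T"])
      show "norm (blinfun_apply T f t) \<le> norm f * norm T" for f
        using norm_bounded[of "blinfun_apply T f" t] norm_blinfun[of T f] by (simp add: mult.commute)
    qed (auto simp: blinfun.add_right blinfun.scaleR_right plus_bcontfun.rep_eq)
    moreover have "\<bar>blinfun_apply T f t\<bar> \<le> norm T * norm f" for f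
      using norm_bounded[of "blinfun_apply T f" t] norm_blinfun[of T f] by simp
    ultimately show ?thesis by (rule functional_representation) blast
  qed
  then obtain a where a: "\<And>t. l1 (a t)" "\<And>f t. blinfun_apply T f t = tot (\<lambda>s. a t s * f s)"
    by metis
  have lim: "((\<lambda>t. tot (\<lambda>s. a t s * F s)) \<longlongrightarrow> tot (\<lambda>s. a pt_inf s * F s)) cofinite"
    if "(F \<longlongrightarrow> F pt_inf) cofinite" for F
  proof -
    have "apply_bcontfun (blinfun_apply T (Bcontfun F)) = (\<lambda>t. tot (\<lambda>s. a t s * F s))"
      by (simp add: fun_eq_iff a(2) apply_Bcontfun_one_point[OF that])
    then show ?thesis
      using bcontfun_tendsto_pt_inf[of "blinfun_apply T (Bcontfun F)"] by simp
  qed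
  have "((\<lambda>t. a t u) \<longlongrightarrow> a pt_inf u) cofinite" if "u \<noteq> pt_inf" for u
    using lim that by (rule coordinate_tendsto)
  then show ?thesis
    using that[of a] a lim[of "\<lambda>_. 1"] tot_row_le_numerical_radius[OF a(1), of T] by simp
qed

lemma operator_of_rows:
  fixes a :: "'g one_point \<Rightarrow> 'g one_point \<Rightarrow> real"
  assumes a: "\<And>t. l1 (a t)" "\<And>t. tot (\<lambda>s. \<bar>a t s\<bar>) \<le> C"
    "((\<lambda>t. tot (a t)) \<longlongrightarrow> tot (a pt_inf)) cofinite"
    "\<And>s. s \<noteq> pt_inf \<Longrightarrow> ((\<lambda>t. a t s) \<longlongrightarrow> a pt_inf s) cofinite"
  obtains T :: "('g one_point \<Rightarrow>\<^sub>C real) \<Rightarrow>\<^sub>L ('g one_point \<Rightarrow>\<^sub>C real)"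
  where "\<And>f t. blinfun_apply T f t = tot (\<lambda>s. a t s * f s)"
proof -
  define S :: "('g one_point \<Rightarrow>\<^sub>C real) \<Rightarrow> ('g one_point \<Rightarrow>\<^sub>C real)"
    where "S = (\<lambda>f. Bcontfun (\<lambda>t. tot (\<lambda>s. a t s * f s)))"
  have S: "S f t = tot (\<lambda>s. a t s * f s)" for f t
    unfolding S_def
    by (subst apply_Bcontfun_one_point) (auto intro: tot_mult_tendsto[OF a(1,2,1,3,4) bcontfun_tendsto_pt_inf])
  note bl = bounded_linear_tot_mult[OF a(1)]
  have "bounded_linear S"
  proof (rule bounded_linear_intro[of _ C])
    show "S (f + g) = S f + S g" for f g
      by (rule bcontfun_eqI) (simp only: S plus_bcontfun.rep_eq[of "S f" "S g"] linear_add[OF bounded_linear.linear[OF bl]])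
    show "S (r *\<^sub>R f) = r *\<^sub>R S f" for r f
      by (rule bcontfun_eqI) (simp add: S mult.left_commute)
    show "norm (S f) \<le> norm f * C" for f
      unfolding norm_bcontfun_le_iff S
    proof
      fix t
      have "\<bar>tot (\<lambda>s. a t s * f s)\<bar> \<le> tot (\<lambda>s. \<bar>a t s\<bar>) * norm f"
        using norm_bounded[of f] by (intro tot_mult_bound a(1)) simp
      also have "\<dots> \<le> C * norm f" by (rule mult_right_mono[OF a(2)]) simp
      finally show "\<bar>tot (\<lambda>s. a t s * f s)\<bar> \<le> norm f * C" by (simp add: mult.commute)
    qed
  qed
  then show ?thesis using that[of "Blinfun S"] by (simp add: bounded_linear_Blinfun_apply S)
qed

lemma norm_le_of_rows:
  fixes T :: "('g one_point \<Rightarrow>\<^sub>C real) \<Rightarrow>\<^sub>L ('g one_point \<Rightarrow>\<^sub>C real)"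
  assumes a: "\<And>t. l1 (a t)" "\<And>t. tot (\<lambda>s. \<bar>a t s\<bar>) \<le> C" and "0 \<le> C"
    and T: "\<And>f t. blinfun_apply T f t = tot (\<lambda>s. a t s * f s)"
  shows "norm T \<le> C"
proof (rule norm_blinfun_bound[OF \<open>0 \<le> C\<close>])
  fix f :: "'g one_point \<Rightarrow>\<^sub>C real"
  have "\<bar>tot (\<lambda>s. a t s * f s)\<bar> \<le> C * norm f" for t
  proof -
    have "\<bar>tot (\<lambda>s. a t s * f s)\<bar> \<le> tot (\<lambda>s. \<bar>a t s\<bar>) * norm f"
      using norm_bounded[of f] by (intro tot_mult_bound a(1)) simp
    also have "\<dots> \<le> C * norm f" by (rule mult_right_mono[OF a(2)]) simp
    finally show ?thesis .
  qed
  then show "norm (blinfun_apply T f) \<le> C * norm f" by (simp add: norm_bcontfun_le_iff T)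
qed


section \<open>The Bishop-Phelps-Bollobas property\<close>

text \<open>Dilation by \<open>1 / (1 - e)\<close> followed by truncation to [-1,1]. For
  \<open>e\<close> strictly between 0 and 1, values of modulus at least \<open>1 - e\<close> become
  1 or -1, and no value in [-1,1] moves by more than \<open>e\<close>.\<close>

definition clip :: "real \<Rightarrow> real \<Rightarrow> real" where
  "clip e x = max (- 1) (min 1 (x / (1 - e)))"

lemma abs_clip_le: "\<bar>clip e x\<bar> \<le> 1"
  by (auto simp: clip_def)

lemma abs_clip_diff_le:
  assumes "0 < e" "e < 1" "\<bar>x\<bar> \<le> 1"
  shows "\<bar>x - clip e x\<bar> \<le> e"
proof -
  consider "x > 1 - e" | "x < - (1 - e)" | "\<bar>x\<bar> \<le> 1 - e" by linarith
  then show ?thesis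
  proof cases
    case 1
    then have "x / (1 - e) > 1" using assms by (simp add: less_divide_eq)
    then show ?thesis using 1 assms by (auto simp: clip_def)
  next
    case 2
    then have "x / (1 - e) < - 1" using assms by (simp add: divide_less_eq)
    then show ?thesis using 2 assms by (auto simp: clip_def)
  next
    case 3
    then have "\<bar>x / (1 - e)\<bar> \<le> 1" using assms by (simp add: divide_le_eq)
    moreover have "max (- 1) (min 1 y) = y" if "\<bar>y\<bar> \<le> 1" for y :: real
      using that by auto
    ultimately have c: "clip e x = x / (1 - e)" unfolding clip_def by blast
    have "x - clip e x = - (x / (1 - e) * e)" using assms by (simp add: c field_simps)
    then have "\<bar>x - clip e x\<bar> = \<bar>x / (1 - e)\<bar> * e" using assms by (simp add: abs_mult)
    also have "\<dots> \<le> 1 * e" using \<open>\<bar>x / (1 - e)\<bar> \<le> 1\<close> assms by (intro mult_right_mono) auto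
    finally show ?thesis by simp
  qed
qed

text \<open>The second hypothesis says that, unless \<open>w = 0\<close>, \<open>x\<close> has the
  sign of \<open>w\<close> and modulus at least \<open>1 - e\<close>.\<close>

lemma mult_clip_eq_abs:
  assumes "e < 1" "(1 - e) * \<bar>w\<bar> \<le> w * x"
  shows "w * clip e x = \<bar>w\<bar>"
proof (cases w "0::real" rule: linorder_cases)
  case less
  then have "w * x \<ge> w * (- (1 - e))" using assms(2) by (simp add: algebra_simps)
  then have "x \<le> - (1 - e)" using less by (simp add: mult_le_cancel_left)
  then have "x / (1 - e) \<le> - 1" using assms(1) by (simp add: divide_le_eq)
  then show ?thesis using less by (simp add: clip_def)
next
  case greater
  then have "w * x \<ge> w * (1 - e)" using assms(2) by (simp add: algebra_simps)
  then have "x \<ge> 1 - e" using greater by (simp add: mult_le_cancel_left)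
  then have "x / (1 - e) \<ge> 1" using assms(1) by (simp add: le_divide_eq)
  then show ?thesis using greater by (simp add: clip_def)
qed simp

text \<open>A Markov argument: where \<open>(1 - e) * |q s| \<le> q s * h s\<close> fails, more than
  \<open>e * |q s|\<close> of the pairing is lost, so these points carry mass at most
  \<open>\<eta> / e\<close>. A finite cutoff removes at most another \<open>\<eta> / e\<close>. The
  mass kept is \<open>S \<ge> 1 - 3 * (\<eta> / e)\<close>, positive by
  \<open>3 * \<eta> < e\<close>. Cutting costs 2 and normalizing 3 units of
  \<open>\<eta> / e\<close>, whence the factor 5. Dividing by \<open>S > 0\<close> keeps all
  signs.\<close>

lemma normalized_truncation:
  assumes q: "l1 q" "tot (\<lambda>s. \<bar>q s\<bar>) \<le> 1" and h: "\<And>s. \<bar>h s\<bar> \<le> 1"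
    and qh: "tot (\<lambda>s. q s * h s) \<ge> 1 - \<eta>"
    and \<eta>: "0 < \<eta>" "0 < e" "e \<le> 1" "3 * \<eta> < e"
  obtains w S where "finite {s. w s \<noteq> 0}" "tot (\<lambda>s. \<bar>w s\<bar>) = 1"
    "tot (\<lambda>s. \<bar>w s - q s\<bar>) \<le> 5 * \<eta> / e"
    "\<And>s. (1 - e) * \<bar>w s\<bar> \<le> w s * h s"
    "S > 0" "\<And>s. w s \<noteq> 0 \<Longrightarrow> w s = q s / S"
proof -
  define E where "E = {s. (1 - e) * \<bar>q s\<bar> \<le> q s * h s}"
  have lq: "l1 (\<lambda>s. \<bar>q s\<bar>)" using q by simp
  have lqh: "l1 (\<lambda>s. q s * h s)" using q(1) h by (rule l1_mult_bounded)
  have qh_le: "q s * h s \<le> \<bar>q s\<bar>" for s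
  proof -
    have "\<bar>q s\<bar> * \<bar>h s\<bar> \<le> \<bar>q s\<bar>" using h[of s] by (simp add: mult_left_le)
    then show ?thesis by (metis abs_le_D1 abs_mult)
  qed
  have "e * tot (\<lambda>s. indicator (-E) s * \<bar>q s\<bar>) = tot (\<lambda>s. e * (indicator (-E) s * \<bar>q s\<bar>))"
    by simp
  also have "\<dots> \<le> tot (\<lambda>s. \<bar>q s\<bar> - q s * h s)"
  proof (rule tot_mono)
    show "e * (indicator (-E) s * \<bar>q s\<bar>) \<le> \<bar>q s\<bar> - q s * h s" for s
      using qh_le[of s] by (cases "s \<in> E") (auto simp: E_def algebra_simps)
  qed (use lq lqh in auto)
  also have "\<dots> \<le> \<eta>" using lq lqh q(2) qh by simp
  finally have tailE: "tot (\<lambda>s. indicator (-E) s * \<bar>q s\<bar>) \<le> \<eta> / e"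
    using \<eta> by (simp add: le_divide_eq mult.commute)
  obtain D0 where D0: "finite D0" "tot (\<lambda>s. indicator (-D0) s * \<bar>q s\<bar>) < \<eta> / e"
    using l1_tail[OF q(1), of "\<eta> / e"] \<eta> by auto
  define D where "D = E \<inter> D0"
  define R where "R = tot (\<lambda>s. indicator (-D) s * \<bar>q s\<bar>)"
  define S where "S = tot (\<lambda>s. indicator D s * \<bar>q s\<bar>)"
  have "R \<le> tot (\<lambda>s. indicator (-E) s * \<bar>q s\<bar> + indicator (-D0) s * \<bar>q s\<bar>)"
    unfolding R_def using lq by (intro tot_mono) (auto simp: D_def split: split_indicator)
  also have "\<dots> \<le> 2 * (\<eta> / e)" using tailE D0(2) lq by simp
  finally have R: "R \<le> 2 * (\<eta> / e)" .
  have "tot (\<lambda>s. \<bar>q s\<bar>) = tot (\<lambda>s. indicator D s * \<bar>q s\<bar> + indicator (-D) s * \<bar>q s\<bar>)"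
    by (intro Bochner_Integration.integral_cong) (auto split: split_indicator)
  also have "\<dots> = S + R" unfolding S_def R_def using lq by simp
  finally have SR: "tot (\<lambda>s. \<bar>q s\<bar>) = S + R" .
  have "1 - \<eta> \<le> S + R" using tot_mono[OF lqh lq qh_le] qh SR by simp
  moreover have "\<eta> \<le> \<eta> / e" using \<eta> by (simp add: le_divide_eq mult_left_le)
  ultimately have S_ge: "S \<ge> 1 - 3 * (\<eta> / e)" using R by linarith
  moreover have "3 * (\<eta> / e) < 1" using \<eta> by (simp add: divide_less_eq)
  ultimately have S0: "S > 0" by linarith
  have "R \<ge> 0" unfolding R_def by (intro Bochner_Integration.integral_nonneg) simp
  then have S1: "S \<le> 1" using q(2) SR by simp
  define w where "w = (\<lambda>s. indicator D s * q s / S)"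
  have abs_w: "\<bar>w s\<bar> = indicator D s * \<bar>q s\<bar> / S" for s
    using S0 by (simp add: w_def abs_mult)
  show ?thesis
  proof (rule that[of w S])
    show "finite {s. w s \<noteq> 0}"
      using D0(1) by (rule finite_subset[rotated]) (auto simp: w_def D_def split: split_indicator_asm)
    show "tot (\<lambda>s. \<bar>w s\<bar>) = 1"
      using S0 by (simp add: abs_w) (simp add: S_def)
    show "(1 - e) * \<bar>w s\<bar> \<le> w s * h s" for s
    proof (cases "s \<in> D")
      case True
      then have "(1 - e) * \<bar>q s\<bar> / S \<le> q s * h s / S"
        using S0 by (intro divide_right_mono) (auto simp: D_def E_def)
      then show ?thesis using True S0 by (simp add: w_def)
    qed (simp add: w_def)
    show "w s = q s / S" if "w s \<noteq> 0" for s
      using that by (auto simp: w_def split: split_indicator_asm split_indicator)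
    have "\<bar>w s - q s\<bar> = indicator (-D) s * \<bar>q s\<bar> + (1 / S - 1) * (indicator D s * \<bar>q s\<bar>)" for s
    proof (cases "s \<in> D")
      case True
      then have "w s - q s = (1 / S - 1) * q s" by (simp add: w_def algebra_simps)
      moreover have "1 / S - 1 \<ge> 0" using S0 S1 by simp
      ultimately show ?thesis using True by (simp add: abs_mult)
    qed (simp add: w_def)
    then have "tot (\<lambda>s. \<bar>w s - q s\<bar>) = R + (1 / S - 1) * S"
      using lq unfolding R_def S_def by simp
    also have "\<dots> = R + (1 - S)" using S0 by (simp add: field_simps)
    also have "\<dots> \<le> 5 * \<eta> / e" using R S_ge by simp
    finally show "tot (\<lambda>s. \<bar>w s - q s\<bar>) \<le> 5 * \<eta> / e" .
  qed (rule S0)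
qed

section \<open>Changing the row at infinity\<close>

lemma tot_abs_diff_compensate:
  assumes x: "l1 x"
  shows "tot (\<lambda>s. \<bar>compensate x s - x s\<bar>) = tot (\<lambda>s. \<bar>x s\<bar>) - max 0 (tot x)"
proof -
  have "\<bar>compensate x s - x s\<bar> = \<bar>x s\<bar> - compensate x s" for s
    using compensate_nonneg[OF x, of s] compensate_le[OF x, of s] by (auto simp: max_def split: if_splits)
  then show ?thesis using x l1_compensate[OF x] tot_compensate[OF x] by simp
qed

text \<open>Replacing the row at infinity by \<open>w\<close> adds \<open>w - a pt_inf\<close> to the nearby rows, whose norms may
  then exceed \<open>1\<close>. Up to a vanishing error the excess sits in the part \<open>\<tau>\<close> of the new row that
  is not yet in the limit at the isolated points. A compensation of \<open>\<tau>\<close> removes it and keeps the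
  total sum in the limit.\<close>

lemma replace_row_at_infinity:
  fixes a :: "'g one_point \<Rightarrow> 'g one_point \<Rightarrow> real"
  assumes a: "\<And>t. l1 (a t)" "\<And>t. tot (\<lambda>s. \<bar>a t s\<bar>) \<le> 1"
    "((\<lambda>t. tot (a t)) \<longlongrightarrow> tot (a pt_inf)) cofinite"
    "\<And>s. s \<noteq> pt_inf \<Longrightarrow> ((\<lambda>t. a t s) \<longlongrightarrow> a pt_inf s) cofinite"
    and w: "finite {s. w s \<noteq> 0}" "tot (\<lambda>s. \<bar>w s\<bar>) = 1" "0 \<le> w pt_inf"
    and \<rho>: "tot (\<lambda>s. \<bar>w s - a pt_inf s\<bar>) \<le> \<rho>" "0 < \<rho>"
  obtains c where "c pt_inf = w" "\<And>t. l1 (c t)" "\<And>t. tot (\<lambda>s. \<bar>c t s\<bar>) \<le> 1"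
    "\<And>t. tot (\<lambda>s. \<bar>c t s - a t s\<bar>) \<le> 4 * \<rho>"
    "((\<lambda>t. tot (c t)) \<longlongrightarrow> tot w) cofinite"
    "\<And>s. s \<noteq> pt_inf \<Longrightarrow> ((\<lambda>t. c t s) \<longlongrightarrow> w s) cofinite"
proof -
  define wp where "wp = w pt_inf"
  define wG where "wG = (\<lambda>s. indicator (-{pt_inf}) s * w s)"
  define D where "D = {s. wG s \<noteq> 0}"
  \<comment> \<open>\<open>wG + \<tau> t\<close> is the shifted row
    \<open>a t + (w - a pt_inf)\<close>. Since \<open>wp\<close> is put into
    \<open>\<tau> t\<close>, its total tends to \<open>wp\<close>, while its coordinates at isolated
    points tend to 0.\<close>
  define \<tau> where "\<tau> = (\<lambda>t s. a t s - a pt_inf s + (if s = pt_inf then wp else 0))"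
  define m where "m = (\<lambda>t. max 0 (tot (\<tau> t)))"
  \<comment> \<open>Bounds the norm of \<open>raw t\<close> and tends to 1, so dividing by it
    restores norm at most 1 without changing limits.\<close>
  define M where "M = (\<lambda>t. max 1 (1 - wp + m t))"
  define raw where "raw = (\<lambda>t s. wG s + compensate (\<tau> t) s)"
  have lw: "l1 w" by (rule l1_finite_support(1)[OF w(1)]) simp
  have lwG: "l1 wG" unfolding wG_def using lw by auto
  have finD: "finite D"
    using w(1) by (rule finite_subset[rotated]) (auto simp: D_def wG_def)
  have pD: "pt_inf \<notin> D" by (simp add: D_def wG_def)
  have l\<tau>: "l1 (\<tau> t)" for t
    unfolding \<tau>_def by (intro Bochner_Integration.integrable_add Bochner_Integration.integrable_diff a(1) l1_single)
  note comp = compensate[OF l\<tau>]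
  have w_split: "w s = wG s + (if s = pt_inf then wp else 0)" for s
    by (simp add: wG_def wp_def)
  have tw: "tot w = tot wG + wp"
    unfolding w_split by (subst Bochner_Integration.integral_add[OF lwG l1_single]) (simp add: tot_single)
  have "tot (\<lambda>s. \<bar>w s\<bar>) = wp + tot (\<lambda>s. \<bar>wG s\<bar>)"
    using tot_split_finite[of "\<lambda>s. \<bar>w s\<bar>" "{pt_inf}"] lw w(3) by (simp add: wG_def wp_def abs_mult)
  then have nG: "tot (\<lambda>s. \<bar>wG s\<bar>) = 1 - wp" using w(2) by simp
  have wp: "0 \<le> wp" "wp \<le> 1"
    using w(3) nG Bochner_Integration.integral_nonneg[of "count_space UNIV" "\<lambda>s. \<bar>wG s\<bar>"] by (auto simp: wp_def)
  have t\<tau>: "tot (\<tau> t) = tot (a t) - tot (a pt_inf) + wp" for t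
  proof -
    have "tot (\<tau> t) = tot (\<lambda>s. a t s - a pt_inf s) + wp"
      unfolding \<tau>_def
      by (subst Bochner_Integration.integral_add[OF Bochner_Integration.integrable_diff[OF a(1) a(1)] l1_single])
        (simp add: tot_single)
    then show ?thesis using a(1) by simp
  qed
  have lim_m: "(m \<longlongrightarrow> wp) cofinite"
  proof -
    have "(m \<longlongrightarrow> max 0 (tot (a pt_inf) - tot (a pt_inf) + wp)) cofinite"
      unfolding m_def t\<tau> by (intro tendsto_intros a(3))
    then show ?thesis using wp by simp
  qed
  have lim_M: "(M \<longlongrightarrow> 1) cofinite"
  proof -
    have "(M \<longlongrightarrow> max 1 (1 - wp + wp)) cofinite"
      unfolding M_def by (intro tendsto_intros lim_m)
    then show ?thesis by simp
  qed
  have lim_\<tau>: "((\<lambda>t. \<bar>\<tau> t s\<bar>) \<longlongrightarrow> 0) cofinite" if "s \<noteq> pt_inf" for s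
  proof -
    have "((\<lambda>t. a t s - a pt_inf s) \<longlongrightarrow> a pt_inf s - a pt_inf s) cofinite"
      by (intro tendsto_intros a(4) that)
    then show ?thesis using that by (simp add: \<tau>_def tendsto_rabs_zero)
  qed
  \<comment> \<open>An upper bound for the mass that compensation removes from
    \<open>\<tau> t\<close>, by \<open>\<tau>_norm\<close> below; its limit is
    \<open>\<rho>\<close>.\<close>
  define d where "d = (\<lambda>t. wp + \<rho> + 2 * (\<Sum>s\<in>D. \<bar>\<tau> t s\<bar>) - m t)"
  have lim_d: "(d \<longlongrightarrow> \<rho>) cofinite"
  proof -
    have "(d \<longlongrightarrow> wp + \<rho> + 2 * (\<Sum>s\<in>D. 0) - wp) cofinite"
      unfolding d_def by (intro tendsto_intros lim_m lim_\<tau>) (use pD in auto)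
    then show ?thesis by simp
  qed
  have lraw: "l1 (raw t)" for t
    unfolding raw_def using lwG comp(1) by (rule Bochner_Integration.integrable_add)
  have raw_norm: "tot (\<lambda>s. \<bar>raw t s\<bar>) \<le> 1 - wp + m t" for t
  proof -
    have "tot (\<lambda>s. \<bar>raw t s\<bar>) \<le> tot (\<lambda>s. \<bar>wG s\<bar> + compensate (\<tau> t) s)"
      using lraw lwG comp(1,2)
      by (intro tot_mono) (auto simp: raw_def intro: order_trans[OF abs_triangle_ineq])
    then show ?thesis using lwG comp(1,4) nG by (simp add: m_def)
  qed
  have \<tau>_norm: "tot (\<lambda>s. \<bar>\<tau> t s\<bar>) \<le> d t + m t" for t
  proof -
    define x where "x = (\<lambda>s. wG s + \<tau> t s)"
    have lx: "l1 x" unfolding x_def using lwG l\<tau> by (rule Bochner_Integration.integrable_add)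
    have lD: "l1 (\<lambda>s. indicator D s * \<bar>\<tau> t s\<bar>)"
      and tD: "tot (\<lambda>s. indicator D s * \<bar>\<tau> t s\<bar>) = (\<Sum>s\<in>D. \<bar>\<tau> t s\<bar>)"
      using l1_finite_support[OF finD, of "\<lambda>s. indicator D s * \<bar>\<tau> t s\<bar>"] by auto
    have xs: "x s = a t s + (w s - a pt_inf s)" for s by (simp add: x_def \<tau>_def w_split)
    have "tot (\<lambda>s. \<bar>x s\<bar>) \<le> tot (\<lambda>s. \<bar>a t s\<bar> + \<bar>w s - a pt_inf s\<bar>)"
      using lx a(1) lw by (intro tot_mono) (auto simp: xs)
    then have nx: "tot (\<lambda>s. \<bar>x s\<bar>) \<le> 1 + \<rho>"
      using a(1,2)[of t] a(1)[of pt_inf] lw \<rho>(1) by simp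
    \<comment> \<open>Off the finite set \<open>D\<close> the row \<open>x\<close> is just
      \<open>\<tau> t\<close>; on \<open>D\<close> the triangle inequality costs
      \<open>2 * |\<tau> t s|\<close>. So the norms of \<open>wG\<close> and \<open>\<tau> t\<close>
      almost add up to that of \<open>x\<close>, which is at most \<open>1 + \<rho>\<close>.\<close>
    have "tot (\<lambda>s. \<bar>\<tau> t s\<bar>) \<le> tot (\<lambda>s. \<bar>x s\<bar> - \<bar>wG s\<bar> + 2 * (indicator D s * \<bar>\<tau> t s\<bar>))"
    proof (rule tot_mono)
      show "\<bar>\<tau> t s\<bar> \<le> \<bar>x s\<bar> - \<bar>wG s\<bar> + 2 * (indicator D s * \<bar>\<tau> t s\<bar>)" for s
        by (cases "s \<in> D") (auto simp: x_def D_def)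
    qed (use l\<tau> lx lwG lD in auto)
    also have "\<dots> = tot (\<lambda>s. \<bar>x s\<bar>) - (1 - wp) + 2 * (\<Sum>s\<in>D. \<bar>\<tau> t s\<bar>)"
      using lx lwG lD by (simp add: nG tD)
    finally show ?thesis using nx by (simp add: d_def)
  qed
  have raw_dist: "tot (\<lambda>s. \<bar>raw t s - a t s\<bar>) \<le> \<rho> + d t" for t
  proof -
    have lc: "l1 (\<lambda>s. \<bar>compensate (\<tau> t) s - \<tau> t s\<bar>)" using comp(1) l\<tau> by auto
    have "tot (\<lambda>s. \<bar>raw t s - a t s\<bar>) \<le> tot (\<lambda>s. \<bar>w s - a pt_inf s\<bar> + \<bar>compensate (\<tau> t) s - \<tau> t s\<bar>)"
    proof (rule tot_mono)
      show "\<bar>raw t s - a t s\<bar> \<le> \<bar>w s - a pt_inf s\<bar> + \<bar>compensate (\<tau> t) s - \<tau> t s\<bar>" for s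
      proof -
        have "\<tau> t s = a t s - a pt_inf s + (if s = pt_inf then wp else 0)" by (simp add: \<tau>_def)
        then show ?thesis using w_split[of s] unfolding raw_def by linarith
      qed
    qed (use lraw lc lw a(1) in auto)
    also have "\<dots> = tot (\<lambda>s. \<bar>w s - a pt_inf s\<bar>) + (tot (\<lambda>s. \<bar>\<tau> t s\<bar>) - m t)"
      using lc lw a(1) by (simp add: tot_abs_diff_compensate[OF l\<tau>] m_def)
    finally show ?thesis using \<rho>(1) \<tau>_norm[of t] by simp
  qed
  define c' where "c' = (\<lambda>t s. raw t s / M t)"
  have M: "M t \<ge> 1" "1 - wp + m t \<le> M t" for t by (simp_all add: M_def)
  have c'_norm: "tot (\<lambda>s. \<bar>c' t s\<bar>) \<le> 1" for t
  proof -
    have "tot (\<lambda>s. \<bar>c' t s\<bar>) = tot (\<lambda>s. \<bar>raw t s\<bar>) / M t"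
      using M(1)[of t] by (simp add: c'_def)
    also have "\<dots> \<le> 1" using M[of t] raw_norm[of t] by (simp add: divide_le_eq_1)
    finally show ?thesis .
  qed
  have c'_dist: "tot (\<lambda>s. \<bar>c' t s - a t s\<bar>) \<le> \<rho> + d t + (M t - 1)" for t
  proof -
    have "tot (\<lambda>s. \<bar>c' t s - a t s\<bar>) \<le> tot (\<lambda>s. (1 - 1 / M t) * \<bar>raw t s\<bar> + \<bar>raw t s - a t s\<bar>)"
    proof (rule tot_mono)
      show "\<bar>c' t s - a t s\<bar> \<le> (1 - 1 / M t) * \<bar>raw t s\<bar> + \<bar>raw t s - a t s\<bar>" for s
      proof -
        have "c' t s - raw t s = - ((1 - 1 / M t) * raw t s)" by (simp add: c'_def algebra_simps)
        moreover have "1 - 1 / M t \<ge> 0" using M(1)[of t] by simp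
        ultimately have "\<bar>c' t s - raw t s\<bar> = (1 - 1 / M t) * \<bar>raw t s\<bar>" by (simp add: abs_mult)
        then show ?thesis by linarith
      qed
    qed (use lraw a(1) in \<open>auto simp: c'_def\<close>)
    also have "\<dots> = (1 - 1 / M t) * tot (\<lambda>s. \<bar>raw t s\<bar>) + tot (\<lambda>s. \<bar>raw t s - a t s\<bar>)"
      using lraw a(1) by simp
    also have "\<dots> \<le> (1 - 1 / M t) * M t + (\<rho> + d t)"
      using M[of t] raw_norm[of t] raw_dist[of t] by (intro add_mono mult_left_mono) auto
    also have "\<dots> = \<rho> + d t + (M t - 1)" using M(1)[of t] by (simp add: field_simps)
    finally show ?thesis .
  qed
  have lc': "l1 (c' t)" for t unfolding c'_def using lraw by simp
  \<comment> \<open>For good \<open>t\<close> the distance is at most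
    \<open>\<rho> + 2 * \<rho> + \<rho>\<close>, the origin of the factor 4. The other rows are
    finitely many and keep \<open>a t\<close>, except at \<open>pt_inf\<close>.\<close>
  define good where "good = (\<lambda>t. d t < 2 * \<rho> \<and> M t < 1 + \<rho> \<and> t \<noteq> pt_inf)"
  have ev: "\<forall>\<^sub>F t in cofinite. good t"
    unfolding good_def using order_tendstoD(2)[OF lim_d, of "2 * \<rho>"] order_tendstoD(2)[OF lim_M, of "1 + \<rho>"] \<rho>(2)
    by (intro eventually_conj) (auto simp: eventually_cofinite)
  define c where "c = (\<lambda>t. if t = pt_inf then w else if good t then c' t else a t)"
  have ev_c: "\<forall>\<^sub>F t in cofinite. c' t = c t"
    using ev by eventually_elim (auto simp: c_def good_def)
  have ct: "l1 (c t) \<and> tot (\<lambda>s. \<bar>c t s\<bar>) \<le> 1 \<and> tot (\<lambda>s. \<bar>c t s - a t s\<bar>) \<le> 4 * \<rho>" for t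
  proof (cases "t = pt_inf")
    case True
    then show ?thesis using lw w(2) \<rho> by (simp add: c_def)
  next
    case False
    then show ?thesis
      using lc'[of t] c'_norm[of t] c'_dist[of t] a(1,2)[of t] \<rho>(2) by (auto simp: c_def good_def)
  qed
  show ?thesis
  proof (rule that[of c])
    have "tot (c' t) = (tot wG + m t) / M t" for t
      unfolding c'_def raw_def using lwG comp(1,4) by (simp add: m_def)
    moreover have "((\<lambda>t. (tot wG + m t) / M t) \<longlongrightarrow> (tot wG + wp) / 1) cofinite"
      by (intro tendsto_intros lim_m lim_M) simp
    ultimately have "((\<lambda>t. tot (c' t)) \<longlongrightarrow> tot w) cofinite" by (simp add: tw)
    then show "((\<lambda>t. tot (c t)) \<longlongrightarrow> tot w) cofinite"
      by (rule Lim_transform_eventually) (use ev_c in eventually_elim, simp)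
    show "((\<lambda>t. c t s) \<longlongrightarrow> w s) cofinite" if s: "s \<noteq> pt_inf" for s
    proof -
      have "\<bar>compensate (\<tau> t) s\<bar> \<le> \<bar>\<tau> t s\<bar>" for t by (rule abs_compensate_le[OF l\<tau>])
      then have "((\<lambda>t. compensate (\<tau> t) s) \<longlongrightarrow> 0) cofinite"
        by (intro Lim_null_comparison[OF _ lim_\<tau>[OF s]]) simp
      then have "((\<lambda>t. c' t s) \<longlongrightarrow> (wG s + 0) / 1) cofinite"
        unfolding c'_def raw_def by (intro tendsto_intros lim_M) auto
      then have "((\<lambda>t. c' t s) \<longlongrightarrow> w s) cofinite" using s by (simp add: wG_def)
      then show ?thesis
        by (rule Lim_transform_eventually) (use ev_c in eventually_elim, simp)
    qed
  qed (use ct in \<open>auto simp: c_def\<close>)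
qed


section \<open>Approximating the operator and the state\<close>

lemma BPBp_numerical_radius_one_point: "BPBp_numerical_radius TYPE('g one_point \<Rightarrow>\<^sub>C real)"
  unfolding BPBp_numerical_radius_def
proof (rule exI[of _ "\<lambda>\<epsilon>. \<epsilon> ^ 3 / 100"], intro conjI allI impI; elim conjE)
  fix \<epsilon> :: real assume \<epsilon>: "0 < \<epsilon>" "\<epsilon> < 1"
  show "0 < \<epsilon> ^ 3 / 100" using \<epsilon> by simp
  have "\<epsilon> ^ 3 \<le> 1" using \<epsilon> by (intro power_le_one) auto
  then show "\<epsilon> ^ 3 / 100 < 1" by simp
next
  fix \<epsilon> :: real and T :: "('g one_point \<Rightarrow>\<^sub>C real) \<Rightarrow>\<^sub>L ('g one_point \<Rightarrow>\<^sub>C real)"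
    and x :: "'g one_point \<Rightarrow>\<^sub>C real" and x'
  assume \<epsilon>: "0 < \<epsilon>" "\<epsilon> < 1" and nrT: "numerical_radius T = 1"
    and xx: "(x, x') \<in> state_pairs"
    and large: "blinfun_apply x' (blinfun_apply T x) \<ge> 1 - \<epsilon> ^ 3 / 100"
  define \<eta> where "\<eta> = \<epsilon>\<^sup>2 / 20"
  define \<delta> where "\<delta> = \<epsilon> ^ 3 / 100"
  define \<rho> where "\<rho> = 5 * \<eta> / \<epsilon>"
  have \<rho>: "\<rho> > 0" "4 * \<rho> = \<epsilon>"
    using \<epsilon> by (simp_all add: \<rho>_def \<eta>_def power2_eq_square)
  have \<eta>: "0 < \<eta>" "\<eta> \<le> 1" "3 * \<eta> < \<epsilon>"
  proof -
    have "\<epsilon>\<^sup>2 < \<epsilon>" using \<epsilon> by (simp add: power2_eq_square)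
    then show "0 < \<eta>" "\<eta> \<le> 1" "3 * \<eta> < \<epsilon>" using \<epsilon> by (simp_all add: \<eta>_def)
  qed
  have \<delta>: "0 < \<delta>" "3 * \<delta> < \<eta>" "5 * \<delta> / \<eta> = \<epsilon>"
  proof -
    have "\<epsilon> ^ 3 < \<epsilon>\<^sup>2" using \<epsilon> by (simp add: power_strict_decreasing)
    moreover have "\<epsilon>\<^sup>2 > 0" using \<epsilon> by simp
    ultimately show "0 < \<delta>" "3 * \<delta> < \<eta>" using \<epsilon> unfolding \<delta>_def \<eta>_def by (simp_all, linarith)
    show "5 * \<delta> / \<eta> = \<epsilon>" using \<epsilon> by (simp add: \<delta>_def \<eta>_def power2_eq_square power3_eq_cube)
  qed
  have x: "norm x = 1" and x': "norm x' = 1" and x'x: "blinfun_apply x' x = 1"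
    using xx by (auto simp: state_pairs_def)
  have x_le: "\<bar>x s\<bar> \<le> 1" for s using norm_bounded[of x s] x by simp

  obtain a where a: "\<And>t. l1 (a t)" "\<And>t. tot (\<lambda>s. \<bar>a t s\<bar>) \<le> 1"
    "\<And>f t. blinfun_apply T f t = tot (\<lambda>s. a t s * f s)"
    "((\<lambda>t. tot (a t)) \<longlongrightarrow> tot (a pt_inf)) cofinite"
    "\<And>s. s \<noteq> pt_inf \<Longrightarrow> ((\<lambda>t. a t s) \<longlongrightarrow> a pt_inf s) cofinite"
    using operator_rows[of T] unfolding nrT by blast
  obtain m where m: "l1 m" "tot (\<lambda>s. \<bar>m s\<bar>) \<le> 1" "\<And>f. blinfun_apply x' f = tot (\<lambda>s. m s * f s)"
    using dual_representation[of x'] unfolding x' by blast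
  define h where "h = apply_bcontfun (blinfun_apply T x)"
  have h_le: "\<bar>h t\<bar> \<le> 1" for t
  proof -
    have "\<bar>h t\<bar> \<le> tot (\<lambda>s. \<bar>a t s\<bar>) * 1"
      unfolding h_def a(3) using a(1) x_le by (rule tot_mult_bound)
    then show ?thesis using a(2)[of t] by simp
  qed
  \<comment> \<open>The terms \<open>|m s| - m s * x s\<close> are nonnegative with total at most 0,
    so each of them vanishes.\<close>
  have mx: "m s * x s = \<bar>m s\<bar>" for s
  proof -
    have lmx: "l1 (\<lambda>s. m s * x s)" using m(1) x_le by (rule l1_mult_bounded)
    have le: "m s * x s \<le> \<bar>m s\<bar>" for s
      using mult_left_le[OF x_le, of "\<bar>m s\<bar>" s] abs_ge_self[of "m s * x s"] by (simp add: abs_mult)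
    have "\<bar>\<bar>m s\<bar> - m s * x s\<bar> \<le> tot (\<lambda>s. \<bar>\<bar>m s\<bar> - m s * x s\<bar>)"
      using m(1) lmx by (intro abs_le_tot) auto
    also have "\<dots> = tot (\<lambda>s. \<bar>m s\<bar>) - 1"
      using m(1) lmx le x'x by (simp add: m(3))
    finally show ?thesis using m(2) by simp
  qed

  have mh: "tot (\<lambda>s. m s * h s) \<ge> 1 - \<delta>" using large by (simp add: m(3) h_def \<delta>_def)
  obtain m0 S where m0: "finite {s. m0 s \<noteq> 0}" "tot (\<lambda>s. \<bar>m0 s\<bar>) = 1"
    "tot (\<lambda>s. \<bar>m0 s - m s\<bar>) \<le> 5 * \<delta> / \<eta>" "\<And>s. (1 - \<eta>) * \<bar>m0 s\<bar> \<le> m0 s * h s"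
    "S > 0" "\<And>s. m0 s \<noteq> 0 \<Longrightarrow> m0 s = m s / S"
    using normalized_truncation[OF m(1,2) h_le mh \<delta>(1) \<eta>(1,2) \<delta>(2)] by blast
  define A where "A = {s. m0 s \<noteq> 0}"
  have m0x: "m0 s * x s = \<bar>m0 s\<bar>" for s
  proof (cases "m0 s = 0")
    case False
    then have e: "m0 s = m s / S" by (rule m0(6))
    show ?thesis unfolding e using m0(5) mx[of s] by simp
  qed simp
  \<comment> \<open>Rescaling \<open>m\<close> keeps the termwise equality with \<open>x\<close>,
    which forces \<open>x\<close> to be 1 or -1 on the support of \<open>m0\<close>; clipping leaves
    such values unchanged.\<close>
  have xA: "x t * x t = 1" if "t \<in> A" for t
  proof -
    have "\<bar>m0 t\<bar> * \<bar>x t\<bar> = \<bar>m0 t\<bar>" using m0x[of t] by (metis abs_abs abs_mult)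
    then have "\<bar>x t\<bar> = 1" using that by (simp add: A_def)
    then show ?thesis by (metis abs_mult_self_eq mult_1)
  qed

  define x0 where "x0 = Bcontfun (\<lambda>s. clip \<epsilon> (x s))"
  have x0: "x0 s = clip \<epsilon> (x s)" for s
  proof -
    have "((\<lambda>s. clip \<epsilon> (x s)) \<longlongrightarrow> clip \<epsilon> (x pt_inf)) cofinite"
      unfolding clip_def using \<epsilon> by (intro tendsto_intros bcontfun_tendsto_pt_inf) auto
    then show ?thesis unfolding x0_def by (subst apply_Bcontfun_one_point) auto
  qed
  have x0A: "x0 t = x t" if "t \<in> A" for t
  proof -
    have "x t * clip \<epsilon> (x t) = \<bar>x t\<bar>"
      using \<epsilon> xA[OF that] x_le[of t] by (intro mult_clip_eq_abs) (auto simp: mult_le_one)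
    moreover have "x t = 1 \<or> x t = - 1"
      using xA[OF that] by (simp add: square_eq_1_iff)
    ultimately show ?thesis by (auto simp: x0)
  qed

  \<comment> \<open>On \<open>A\<close>, where \<open>x t * x t = 1\<close>, the last condition says
    \<open>0 \<le> r t\<close>. At \<open>t = pt_inf\<close> it becomes the hypothesis
    \<open>0 \<le> w pt_inf\<close> of \<open>replace_row_at_infinity\<close>.\<close>
  define attaining where "attaining = (\<lambda>t r. finite {s. r s \<noteq> 0} \<and> tot (\<lambda>s. \<bar>r s\<bar>) = 1 \<and>
      tot (\<lambda>s. \<bar>r s - a t s\<bar>) \<le> \<rho> \<and> tot (\<lambda>s. r s * x0 s) = x t \<and> 0 \<le> r t * x t * x t)"
  have "\<exists>r. attaining t r" if t: "t \<in> A" for t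
  proof -
    have xt: "\<bar>x t\<bar> = 1" using xA[OF t] by (metis abs_mult_self_eq abs_one abs_square_eq_1 power2_eq_square)
    \<comment> \<open>The factor \<open>x t\<close> turns the target value \<open>x t\<close> into
      1, as \<open>normalized_truncation\<close> requires; since \<open>x t * x t = 1\<close>,
      multiplying by it again undoes the change.\<close>
    define q where "q = (\<lambda>s. x t * a t s)"
    have "1 - \<eta> \<le> x t * h t"
    proof -
      have "m0 t = \<bar>m0 t\<bar> * x t" using xA[OF t] by (simp flip: m0x[of t] add: mult.assoc)
      then have "m0 t * h t = x t * h t * \<bar>m0 t\<bar>" by (metis mult.assoc mult.commute)
      then have "(1 - \<eta>) * \<bar>m0 t\<bar> \<le> x t * h t * \<bar>m0 t\<bar>" using m0(4)[of t] by linarith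
      then show ?thesis using t by (simp add: A_def)
    qed
    then have qh: "tot (\<lambda>s. q s * x s) \<ge> 1 - \<eta>" by (simp add: q_def h_def a(3) mult.assoc)
    have q: "l1 q" "tot (\<lambda>s. \<bar>q s\<bar>) \<le> 1" using a(1,2)[of t] xt by (simp_all add: q_def abs_mult)
    obtain w S where w: "finite {s. w s \<noteq> 0}" "tot (\<lambda>s. \<bar>w s\<bar>) = 1"
      "tot (\<lambda>s. \<bar>w s - q s\<bar>) \<le> 5 * \<eta> / \<epsilon>" "\<And>s. (1 - \<epsilon>) * \<bar>w s\<bar> \<le> w s * x s"
      "S > 0" "\<And>s. w s \<noteq> 0 \<Longrightarrow> w s = q s / S"
      using normalized_truncation[OF q x_le qh \<eta>(1) \<epsilon>(1) less_imp_le[OF \<epsilon>(2)] \<eta>(3)] by blast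
    define r where "r = (\<lambda>s. x t * w s)"
    have "finite {s. r s \<noteq> 0}" using w(1) by (rule finite_subset[rotated]) (auto simp: r_def)
    moreover have "tot (\<lambda>s. \<bar>r s\<bar>) = 1" using w(2) xt by (simp add: r_def abs_mult)
    moreover have "tot (\<lambda>s. \<bar>r s - a t s\<bar>) \<le> \<rho>"
    proof -
      have "r s - a t s = x t * (w s - q s)" for s
        using xA[OF t] by (simp add: r_def q_def right_diff_distrib mult.assoc[symmetric])
      then show ?thesis using w(3) xt by (simp add: abs_mult \<rho>_def)
    qed
    moreover have "tot (\<lambda>s. r s * x0 s) = x t"
    proof -
      have "r s * x0 s = x t * \<bar>w s\<bar>" for s
        using mult_clip_eq_abs[OF \<epsilon>(2) w(4), of s] by (simp add: r_def x0 mult.assoc)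
      then show ?thesis using w(2) by simp
    qed
    moreover have "0 \<le> r t * x t * x t"
    proof -
      have "r t * x t * x t = w t * x t" using xA[OF t] by (simp add: r_def mult_ac)
      then show ?thesis using w(4)[of t] \<epsilon> by (smt (verit) mult_nonneg_nonneg abs_ge_zero)
    qed
    ultimately have "attaining t r" unfolding attaining_def by (intro conjI)
    then show ?thesis by (rule exI[of _ r])
  qed
  then obtain R where "\<And>t. t \<in> A \<Longrightarrow> attaining t (R t)" by metis
  then have R: "\<And>t. t \<in> A \<Longrightarrow> finite {s. R t s \<noteq> 0}" "\<And>t. t \<in> A \<Longrightarrow> tot (\<lambda>s. \<bar>R t s\<bar>) = 1"
    "\<And>t. t \<in> A \<Longrightarrow> tot (\<lambda>s. \<bar>R t s - a t s\<bar>) \<le> \<rho>"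
    "\<And>t. t \<in> A \<Longrightarrow> tot (\<lambda>s. R t s * x0 s) = x t"
    "\<And>t. t \<in> A \<Longrightarrow> 0 \<le> R t t * x t * x t"
    unfolding attaining_def by blast+

  obtain c where c: "pt_inf \<in> A \<Longrightarrow> c pt_inf = R pt_inf"
    "\<And>t. l1 (c t)" "\<And>t. tot (\<lambda>s. \<bar>c t s\<bar>) \<le> 1" "\<And>t. tot (\<lambda>s. \<bar>c t s - a t s\<bar>) \<le> 4 * \<rho>"
    "((\<lambda>t. tot (c t)) \<longlongrightarrow> tot (c pt_inf)) cofinite"
    "\<And>s. s \<noteq> pt_inf \<Longrightarrow> ((\<lambda>t. c t s) \<longlongrightarrow> c pt_inf s) cofinite"
  proof (cases "pt_inf \<in> A")
    case True
    have R0: "0 \<le> R pt_inf pt_inf" using R(5)[OF True] xA[OF True] by (simp add: mult.assoc)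
    show ?thesis
    proof (rule replace_row_at_infinity[OF a(1,2,4,5) R(1,2)[OF True] R0 R(3)[OF True] \<rho>(1)])
      fix c assume c: "c pt_inf = R pt_inf" "\<And>t. l1 (c t)" "\<And>t. tot (\<lambda>s. \<bar>c t s\<bar>) \<le> 1"
        "\<And>t. tot (\<lambda>s. \<bar>c t s - a t s\<bar>) \<le> 4 * \<rho>"
        "((\<lambda>t. tot (c t)) \<longlongrightarrow> tot (R pt_inf)) cofinite"
        "\<And>s. s \<noteq> pt_inf \<Longrightarrow> ((\<lambda>t. c t s) \<longlongrightarrow> R pt_inf s) cofinite"
      show ?thesis
        by (rule that[of c]) (simp_all add: c)
    qed
  next
    case False
    show ?thesis
      by (rule that[of a]) (use False a(1,2,4,5) \<rho>(1) in simp_all)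
  qed
  \<comment> \<open>Only finitely many rows differ from \<open>c\<close>, so the limits are those of
    \<open>c\<close>, and the row at \<open>pt_inf\<close> already agrees with
    \<open>c pt_inf\<close>.\<close>
  define b where "b = (\<lambda>t. if t \<in> A then R t else c t)"
  have b: "l1 (b t)" "tot (\<lambda>s. \<bar>b t s\<bar>) \<le> 1" "tot (\<lambda>s. \<bar>b t s - a t s\<bar>) \<le> \<epsilon>" for t
  proof -
    have "l1 (b t) \<and> tot (\<lambda>s. \<bar>b t s\<bar>) \<le> 1 \<and> tot (\<lambda>s. \<bar>b t s - a t s\<bar>) \<le> \<epsilon>"
    proof (cases "t \<in> A")
      case True
      have "l1 (R t)" by (rule l1_finite_support(1)[OF R(1)[OF True]]) simp
      moreover have "tot (\<lambda>s. \<bar>R t s - a t s\<bar>) \<le> \<epsilon>" using R(3)[OF True] \<rho> by linarith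
      ultimately show ?thesis using True R(2)[OF True] by (simp add: b_def)
    next
      case False
      then show ?thesis using c(2,3)[of t] c(4)[of t] \<rho>(2) by (simp add: b_def)
    qed
    then show "l1 (b t)" "tot (\<lambda>s. \<bar>b t s\<bar>) \<le> 1" "tot (\<lambda>s. \<bar>b t s - a t s\<bar>) \<le> \<epsilon>" by blast+
  qed
  have bp: "b pt_inf = c pt_inf" using c(1) by (simp add: b_def)
  have ev: "\<forall>\<^sub>F t in cofinite. c t = b t"
    unfolding eventually_cofinite using m0(1) by (rule finite_subset[rotated]) (auto simp: b_def A_def)
  have b_lim: "((\<lambda>t. tot (b t)) \<longlongrightarrow> tot (b pt_inf)) cofinite"
    unfolding bp by (rule Lim_transform_eventually[OF c(5)]) (use ev in eventually_elim, simp)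
  have b_lim': "((\<lambda>t. b t s) \<longlongrightarrow> b pt_inf s) cofinite" if "s \<noteq> pt_inf" for s
    unfolding bp by (rule Lim_transform_eventually[OF c(6)[OF that]]) (use ev in eventually_elim, simp)
  obtain T0 :: "('g one_point \<Rightarrow>\<^sub>C real) \<Rightarrow>\<^sub>L ('g one_point \<Rightarrow>\<^sub>C real)"
    where T0: "\<And>f t. blinfun_apply T0 f t = tot (\<lambda>s. b t s * f s)"
    using operator_of_rows[OF b(1,2) b_lim b_lim'] by blast

  have lm0: "l1 m0" by (rule l1_finite_support(1)[OF m0(1)]) simp
  define x0' where "x0' = Blinfun (\<lambda>f :: 'g one_point \<Rightarrow>\<^sub>C real. tot (\<lambda>s. m0 s * f s))"
  have x0': "blinfun_apply x0' f = tot (\<lambda>s. m0 s * f s)" for f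
    unfolding x0'_def by (simp add: bounded_linear_Blinfun_apply[OF bounded_linear_tot_mult[OF lm0]])
  have m0x0: "m0 s * x0 s = \<bar>m0 s\<bar>" for s
    using m0x[of s] x0A[of s] by (cases "s \<in> A") (auto simp: A_def)
  have state: "(x0, x0') \<in> state_pairs"
  proof (rule state_pairI)
    show "norm x0 \<le> 1" by (simp add: norm_bcontfun_le_iff x0 abs_clip_le)
    show "norm x0' \<le> 1" using norm_le_of_representation[OF lm0 x0'] m0(2) by simp
    show "blinfun_apply x0' x0 = 1" by (simp add: x0' m0x0 m0(2))
  qed
  have attains: "blinfun_apply x0' (blinfun_apply T0 x0) = 1"
  proof -
    have "m0 t * blinfun_apply T0 x0 t = \<bar>m0 t\<bar>" for t
      using R(4)[of t] m0x[of t] by (cases "t \<in> A") (auto simp: T0 b_def A_def)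
    then show ?thesis by (simp add: x0' m0(2))
  qed
  have nrT0: "numerical_radius T0 = 1"
  proof (rule antisym)
    show "numerical_radius T0 \<le> 1"
      using numerical_radius_le_norm[OF state, of T0] norm_le_of_rows[OF b(1,2) _ T0] by simp
    show "1 \<le> numerical_radius T0"
      using abs_state_pair_le_numerical_radius[OF state, of T0] by (simp add: attains)
  qed
  have close: "numerical_radius (T - T0) \<le> \<epsilon>"
  proof -
    have "blinfun_apply (T - T0) f t = tot (\<lambda>s. (a t s - b t s) * f s)" for f t
    proof -
      have "l1 (\<lambda>s. a t s * f s)" "l1 (\<lambda>s. b t s * f s)"
        using a(1) b(1) norm_bounded[of f] by (auto intro!: l1_mult_bounded[where C = "norm f"])
      then show ?thesis
        by (simp add: blinfun.diff_left minus_bcontfun.rep_eq a(3) T0 left_diff_distrib)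
    qed
    moreover have "tot (\<lambda>s. \<bar>a t s - b t s\<bar>) \<le> \<epsilon>" for t
      using b(3)[of t] by (simp add: abs_minus_commute)
    ultimately have "norm (T - T0) \<le> \<epsilon>"
      using a(1) b(1) \<epsilon> by (intro norm_le_of_rows[where a = "\<lambda>t s. a t s - b t s"]) auto
    then show ?thesis using numerical_radius_le_norm[OF state, of "T - T0"] by simp
  qed
  have close_x: "norm (x - x0) \<le> \<epsilon>"
    using abs_clip_diff_le[OF \<epsilon> x_le] by (simp add: norm_bcontfun_le_iff minus_bcontfun.rep_eq x0)
  have close_x': "norm (x' - x0') \<le> \<epsilon>"
  proof -
    have "blinfun_apply (x' - x0') f = tot (\<lambda>s. (m s - m0 s) * f s)" for f
    proof -
      have "l1 (\<lambda>s. m s * f s)" "l1 (\<lambda>s. m0 s * f s)"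
        using m(1) lm0 norm_bounded[of f] by (auto intro!: l1_mult_bounded[where C = "norm f"])
      then show ?thesis by (simp add: blinfun.diff_left m(3) x0' left_diff_distrib)
    qed
    then have "norm (x' - x0') \<le> tot (\<lambda>s. \<bar>m s - m0 s\<bar>)"
      using m(1) lm0 by (intro norm_le_of_representation) auto
    then show ?thesis using m0(3) \<delta>(3) by (simp add: abs_minus_commute)
  qed
  show "\<exists>T0 x0 x0'. numerical_radius T0 = 1 \<and> (x0, x0') \<in> state_pairs \<and>
      blinfun_apply x0' (blinfun_apply T0 x0) = 1 \<and>
      numerical_radius (T - T0) \<le> \<epsilon> \<and> norm (x - x0) \<le> \<epsilon> \<and> norm (x' - x0') \<le> \<epsilon>"
    using nrT0 state attains close close_x close_x' by blast
qed

theorem theorem4p8: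
  shows "admits_local_compensation TYPE('g one_point) \<and>
         BPBp_numerical_radius TYPE('g one_point \<Rightarrow>\<^sub>C real)"
  using admits_local_compensation_one_point BPBp_numerical_radius_one_point by blast

end
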